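(* Let $0<\alpha\le 1$ and let $F\subset\mathbb{R}^p$ be compact. Then there is a dense $G_\delta$ subset $\mathcal{G}$ of $C_1^\alpha(F)$ such that $D_*^f(F)=D_*(\alpha,F)$ for every $f\in\mathcal{G}$.
   Context: A function $f:F\to\mathbb{R}$ is $1$-Hölder-$\alpha$ if $|f(x)-f(y)|\le |x-y|^\alpha$ for all $x,y\in F$. $C_1^\alpha(F)$ denotes the set of all $1$-Hölder-$\alpha$ functions on $F$, equipped with the metric of the supremum norm. $\lambda$ is one-dimensional Lebesgue measure and $\dim_H$ is Hausdorff dimension (with $\dim_H\emptyset=\inf\{s\ge 0:\mathcal H^s(\emptyset)=0\}=0$). For $f:F\to\mathbb{R}$ and $r\in\mathbb{R}$ put $D^f(r,F)=\dim_H(f^{-1}(r))$ and $$D_*^f(F)=\sup\{d:\lambda\{r: D^f(r,F)\ge d\}>0\}.$$ Let $\mathfrak{G}_{1,\alpha}(F)$ be the family of all dense $G_\delta$ subsets of $C_1^\alpha(F)$, and set $$D_*(\alpha,F)=\sup_{\mathcal{G}\in\mathfrak{G}_{1,\alpha}(F)}\inf\{D_*^f(F): f\in\mathcal{G}\}.$$ *)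

theory Defs
  imports "HOL-Analysis.Analysis"
begin

section \<open>Hausdorff measure and Hausdorff dimension\<close>

text \<open>
  The contribution of a covering set to the sum \<open>\<Sum> (diam U)^s\<close>. For \<open>s = 0\<close> every nonempty set
  counts \<open>1\<close> and the empty set counts \<open>0\<close>, so that the \<open>0\<close>-dimensional measure is counting
  measure; note that \<open>0 powr 0 = 0\<close>, hence the case distinction.
\<close>

definition diam_pow :: "real \<Rightarrow> 'a::metric_space set \<Rightarrow> ennreal" where
  "diam_pow s U =
     (if U = {} then 0 else if s = 0 then 1 else ennreal (diameter U powr s))"

text \<open>
  Boundedness is demanded explicitly because \<^const>\<open>diameter\<close> is unspecified on unbounded sets.
  Finite covers are included, as some of the \<open>U i\<close> may be empty.
\<close>

definition hausdorff_premeasure :: "real \<Rightarrow> real \<Rightarrow> 'a::metric_space set \<Rightarrow> ennreal" where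
  "hausdorff_premeasure s \<delta> A =
     (INF U \<in> {U :: nat \<Rightarrow> 'a set. A \<subseteq> (\<Union>i. U i) \<and> (\<forall>i. bounded (U i) \<and> diameter (U i) \<le> \<delta>)}.
        (\<Sum>i. diam_pow s (U i)))"

definition hausdorff_measure :: "real \<Rightarrow> 'a::metric_space set \<Rightarrow> ennreal" where
  "hausdorff_measure s A = (SUP \<delta> \<in> {0<..}. hausdorff_premeasure s \<delta> A)"

definition hausdorff_dim :: "'a::metric_space set \<Rightarrow> ereal" where
  "hausdorff_dim A = (INF s \<in> {s :: real. 0 \<le> s \<and> hausdorff_measure s A = 0}. ereal s)"

section \<open>The space of 1-Hoelder functions on a set\<close>

text \<open>
  A function on \<open>F\<close> is represented by its extension with value \<^const>\<open>undefined\<close> outside \<open>F\<close>, so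
  equality of representatives is equality on \<open>F\<close>.
\<close>

definition holder1 :: "real \<Rightarrow> 'a::metric_space set \<Rightarrow> ('a \<Rightarrow> real) set" where
  "holder1 \<alpha> F =
     {f \<in> extensional F. \<forall>x\<in>F. \<forall>y\<in>F. \<bar>f x - f y\<bar> \<le> dist x y powr \<alpha>}"

text \<open>
  The supremum metric. The library's metric locale asks for nonnegativity on the whole type, so the
  distance is set to \<open>0\<close> outside the space; it is also \<open>0\<close> on the one-point space over \<open>F = {}\<close>.
\<close>

definition holder1_dist ::
  "real \<Rightarrow> 'a::metric_space set \<Rightarrow> ('a \<Rightarrow> real) \<Rightarrow> ('a \<Rightarrow> real) \<Rightarrow> real" where
  "holder1_dist \<alpha> F f g =
     (if f \<in> holder1 \<alpha> F \<and> g \<in> holder1 \<alpha> F \<and> F \<noteq> {} then (SUP x\<in>F. \<bar>f x - g x\<bar>) else 0)"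

definition holder1_topology :: "real \<Rightarrow> 'a::metric_space set \<Rightarrow> ('a \<Rightarrow> real) topology" where
  "holder1_topology \<alpha> F = Metric_space.mtopology (holder1 \<alpha> F) (holder1_dist \<alpha> F)"

lemma holder1_diff_bdd_above:
  assumes F: "compact F" and \<alpha>: "0 < \<alpha>" and f: "f \<in> holder1 \<alpha> F" and g: "g \<in> holder1 \<alpha> F"
  shows "bdd_above ((\<lambda>x. \<bar>f x - g x\<bar>) ` F)"
proof (cases "F = {}")
  case False
  then obtain a where a: "a \<in> F" by blast
  obtain B where B: "\<And>x y. x \<in> F \<Longrightarrow> y \<in> F \<Longrightarrow> dist x y \<le> B"
    using compact_imp_bounded[OF F] bounded_two_points by metis
  show ?thesis
  proof (rule bdd_aboveI2)
    fix x assume x: "x \<in> F"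
    have "dist x a powr \<alpha> \<le> B powr \<alpha>"
      using B[OF x a] \<alpha> by (intro powr_mono2) auto
    moreover have "\<bar>f x - f a\<bar> \<le> dist x a powr \<alpha>" "\<bar>g x - g a\<bar> \<le> dist x a powr \<alpha>"
      using f g x a by (auto simp: holder1_def)
    ultimately show "\<bar>f x - g x\<bar> \<le> 2 * B powr \<alpha> + \<bar>f a - g a\<bar>"
      by linarith
  qed
qed simp

lemma Metric_space_holder1:
  assumes F: "compact F" and \<alpha>: "0 < \<alpha>"
  shows "Metric_space (holder1 \<alpha> F) (holder1_dist \<alpha> F)"
proof
  have le: "\<bar>f x - g x\<bar> \<le> holder1_dist \<alpha> F f g"
    if "f \<in> holder1 \<alpha> F" "g \<in> holder1 \<alpha> F" "x \<in> F" for f g x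
    using that holder1_diff_bdd_above[OF F \<alpha> that(1,2)]
    by (auto simp: holder1_dist_def intro: cSUP_upper)
  show "0 \<le> holder1_dist \<alpha> F f g" for f g
  proof (cases "f \<in> holder1 \<alpha> F \<and> g \<in> holder1 \<alpha> F \<and> F \<noteq> {}")
    case True
    then obtain a where "a \<in> F" by blast
    then show ?thesis using le[of f g a] True by linarith
  qed (simp only: holder1_dist_def if_False order_refl)
  show "holder1_dist \<alpha> F f g = holder1_dist \<alpha> F g f" for f g
    by (simp add: holder1_dist_def abs_minus_commute conj_ac)
  show "holder1_dist \<alpha> F f g = 0 \<longleftrightarrow> f = g"
    if fg: "f \<in> holder1 \<alpha> F" "g \<in> holder1 \<alpha> F" for f g
  proof
    assume "holder1_dist \<alpha> F f g = 0"
    then have "f x = g x" if "x \<in> F" for x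
      using le[OF fg that] by simp
    then show "f = g"
      using fg by (auto simp: holder1_def intro: extensionalityI)
  qed (simp add: holder1_dist_def)
  show "holder1_dist \<alpha> F f h \<le> holder1_dist \<alpha> F f g + holder1_dist \<alpha> F g h"
    if fgh: "f \<in> holder1 \<alpha> F" "g \<in> holder1 \<alpha> F" "h \<in> holder1 \<alpha> F" for f g h
  proof (cases "F = {}")
    case False
    have "(SUP x\<in>F. \<bar>f x - h x\<bar>) \<le> holder1_dist \<alpha> F f g + holder1_dist \<alpha> F g h"
    proof (rule cSUP_least[OF False])
      fix x assume "x \<in> F"
      then show "\<bar>f x - h x\<bar> \<le> holder1_dist \<alpha> F f g + holder1_dist \<alpha> F g h"
        using le[of f g x] le[of g h x] fgh by linarith
    qed
    then show ?thesis using fgh False by (simp add: holder1_dist_def[of \<alpha> F f h])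
  qed (simp add: holder1_dist_def)
qed

definition dense_gdeltas :: "real \<Rightarrow> 'a::metric_space set \<Rightarrow> ('a \<Rightarrow> real) set set" where
  "dense_gdeltas \<alpha> F =
     {G. gdelta_in (holder1_topology \<alpha> F) G \<and>
         holder1_topology \<alpha> F closure_of G = topspace (holder1_topology \<alpha> F)}"

section \<open>Dimension of level sets\<close>

definition level_dim :: "('a::metric_space \<Rightarrow> real) \<Rightarrow> real \<Rightarrow> 'a set \<Rightarrow> ereal" where
  "level_dim f r F = hausdorff_dim {x \<in> F. f x = r}"

text \<open>
  For \<open>d \<le> 0\<close> the set of levels is all of \<open>\<real>\<close>, of infinite measure; hence \<^const>\<open>emeasure\<close>.
\<close>

definition Dstar_fun :: "('a::metric_space \<Rightarrow> real) \<Rightarrow> 'a set \<Rightarrow> ereal" where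
  "Dstar_fun f F =
     (SUP d \<in> {d :: real. emeasure lebesgue {r. level_dim f r F \<ge> ereal d} > 0}. ereal d)"

definition Dstar :: "real \<Rightarrow> 'a::metric_space set \<Rightarrow> ereal" where
  "Dstar \<alpha> F = (SUP G \<in> dense_gdeltas \<alpha> F. INF f \<in> G. Dstar_fun f F)"

end

theory Submission
  imports Defs
begin

text \<open>
  Fix \<open>s > 0\<close> and let \<open>E\<close> be the set of those 1-Hoelder functions for which almost every level
  set has \<open>s\<close>-dimensional Hausdorff measure zero (\<open>null_level_functions\<close>). Functions in \<open>E\<close> satisfy
  \<open>Dstar_fun f F \<le> s\<close>, and functions outside \<open>E\<close> satisfy \<open>Dstar_fun f F \<ge> s\<close>. The theorem follows
  from a zero-one law: if \<open>s > Dstar \<alpha> F\<close>, then \<open>E\<close> is a dense \<open>G\<^sub>\<delta>\<close>. For then, by Baire's theorem,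
  one may intersect these sets, for rational \<open>s > Dstar \<alpha> F\<close>, with a sequence of dense \<open>G\<^sub>\<delta>\<close> sets along
  which the supremum defining \<open>Dstar \<alpha> F\<close> is reached.

  That \<open>E\<close> is a \<open>G\<^sub>\<delta>\<close> comes from compactness: an efficient open cover of one level set of \<open>f\<close> also
  covers all nearby level sets of all nearby functions (\<open>open_thin_levels_stable\<close>).

  Density is the core. If the closure of \<open>E\<close> contained no ball, its complement would be a dense open
  set contradicting \<open>s > Dstar \<alpha> F\<close>; so it contains a ball around some \<open>u\<close>. To spread from this ball
  over the whole space one uses that \<open>E\<close> is closed under \<open>max\<close>, \<open>min\<close>, shifts and reflections
  \<open>c - f\<close>, because these operations produce level sets inside unions of two old ones.
  First, putting steep cones on \<open>u\<close> yields members of the ball that separate any two points as far as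
  the Hoelder condition and the radius permit (\<open>separating_perturbation\<close>); the lattice version of
  the Stone-Weierstrass theorem then places every function of small oscillation in the closure of
  \<open>E\<close> (\<open>small_oscillation_in_closure\<close>). Secondly, a function of large range with Hoelder constant
  below \<open>1\<close> is folded at the middle of its range; an approximation of the folded function, cut off
  just below the crease, can be unfolded again inside \<open>E\<close> (\<open>unfold_in_closure\<close>). Repeated doubling
  of the range reaches all such functions, and they are dense (\<open>null_level_functions_dense\<close>).
\<close>

section \<open>Sets of Hausdorff measure zero\<close>

lemma ennreal_eq_0_if_le_all:
  fixes x :: ennreal
  assumes "\<And>e. 0 < e \<Longrightarrow> x \<le> ennreal e"
  shows "x = 0"
proof -
  have "x \<le> 0 + ennreal e" if "0 < e" for e
    using assms[OF that] by simp
  then have "x \<le> 0" by (rule ennreal_le_epsilon)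
  then show ?thesis by simp
qed

lemma hausdorff_measure_eq_0_iff:
  "hausdorff_measure s A = 0 \<longleftrightarrow> (\<forall>\<delta>>0. hausdorff_premeasure s \<delta> A = 0)"
  unfolding hausdorff_measure_def bot_ennreal[symmetric] SUP_bot_conv by auto

lemma hausdorff_premeasure_less_iff:
  "hausdorff_premeasure s \<delta> A < c \<longleftrightarrow>
     (\<exists>U :: nat \<Rightarrow> 'a::metric_space set. A \<subseteq> (\<Union>i. U i) \<and> (\<forall>i. bounded (U i)) \<and>
        (\<forall>i. diameter (U i) \<le> \<delta>) \<and> (\<Sum>i. diam_pow s (U i)) < c)"
  unfolding hausdorff_premeasure_def INF_less_iff by blast

lemma hausdorff_premeasure_le:
  assumes "A \<subseteq> (\<Union>i::nat. U i)" "\<And>i. bounded (U i)" "\<And>i. diameter (U i) \<le> \<delta>"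
  shows "hausdorff_premeasure s \<delta> A \<le> (\<Sum>i. diam_pow s (U i))"
  unfolding hausdorff_premeasure_def using assms by (intro INF_lower) auto

lemma hausdorff_measure_0_subset:
  assumes "hausdorff_measure s B = 0" "A \<subseteq> B"
  shows "hausdorff_measure s A = 0"
proof -
  have "hausdorff_premeasure s \<delta> A \<le> hausdorff_premeasure s \<delta> B" for \<delta>
    unfolding hausdorff_premeasure_def using assms(2) by (intro INF_superset_mono) auto
  then show ?thesis
    using assms(1) unfolding hausdorff_measure_eq_0_iff by (metis le_zero_eq)
qed

lemma sum_alternating:
  fixes a b :: "nat \<Rightarrow> 'b::comm_monoid_add"
  shows "(\<Sum>i<2*n. if even i then a (i div 2) else b (i div 2)) = (\<Sum>i<n. a i) + (\<Sum>i<n. b i)"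
  by (induction n) (auto simp: ac_simps)

lemma hausdorff_measure_0_Un:
  assumes A: "hausdorff_measure s A = 0" and B: "hausdorff_measure s B = 0"
  shows "hausdorff_measure s (A \<union> B) = 0"
  unfolding hausdorff_measure_eq_0_iff
proof (intro allI impI)
  fix \<delta> :: real assume \<delta>: "\<delta> > 0"
  have "hausdorff_premeasure s \<delta> (A \<union> B) \<le> ennreal e" if e: "e > 0" for e
  proof -
    have pos: "0 < ennreal (e/2)" using e by simp
    have "hausdorff_premeasure s \<delta> A < ennreal (e/2)"
      using A[unfolded hausdorff_measure_eq_0_iff] \<delta> pos by simp
    then obtain U where U: "A \<subseteq> (\<Union>i::nat. U i)" "\<And>i. bounded (U i)" "\<And>i. diameter (U i) \<le> \<delta>"
      "(\<Sum>i. diam_pow s (U i)) < ennreal (e/2)"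
      unfolding hausdorff_premeasure_less_iff by blast
    have "hausdorff_premeasure s \<delta> B < ennreal (e/2)"
      using B[unfolded hausdorff_measure_eq_0_iff] \<delta> pos by simp
    then obtain V where V: "B \<subseteq> (\<Union>i::nat. V i)" "\<And>i. bounded (V i)" "\<And>i. diameter (V i) \<le> \<delta>"
      "(\<Sum>i. diam_pow s (V i)) < ennreal (e/2)"
      unfolding hausdorff_premeasure_less_iff by blast
    define W where "W i = (if even i then U (i div 2) else V (i div 2))" for i
    have W_even: "U i = W (2*i)" and W_odd: "V i = W (2*i+1)" for i by (auto simp: W_def)
    have "(\<Union>i. U i) \<subseteq> (\<Union>i. W i)"
      unfolding W_even by (intro UN_least UN_upper UNIV_I)
    moreover have "(\<Union>i. V i) \<subseteq> (\<Union>i. W i)"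
      unfolding W_odd by (intro UN_least UN_upper UNIV_I)
    ultimately have "A \<union> B \<subseteq> (\<Union>i. W i)" using U(1) V(1) by (meson Un_least order_trans)
    then have "hausdorff_premeasure s \<delta> (A \<union> B) \<le> (\<Sum>i. diam_pow s (W i))"
      using U V by (intro hausdorff_premeasure_le) (auto simp: W_def)
    also have "\<dots> \<le> (\<Sum>i. diam_pow s (U i)) + (\<Sum>i. diam_pow s (V i))"
    proof (rule suminf_le_const)
      fix n
      have "(\<Sum>i<n. diam_pow s (W i)) \<le> (\<Sum>i<2*n. diam_pow s (W i))"
        by (intro sum_mono2) auto
      also have "\<dots> = (\<Sum>i<2*n. if even i then diam_pow s (U (i div 2)) else diam_pow s (V (i div 2)))"
        by (intro sum.cong) (auto simp: W_def)
      also have "\<dots> = (\<Sum>i<n. diam_pow s (U i)) + (\<Sum>i<n. diam_pow s (V i))"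
        by (rule sum_alternating)
      also have "\<dots> \<le> (\<Sum>i. diam_pow s (U i)) + (\<Sum>i. diam_pow s (V i))"
        by (intro add_mono sum_le_suminf) auto
      finally show "(\<Sum>i<n. diam_pow s (W i)) \<le> \<dots>" .
    qed auto
    also have "\<dots> \<le> ennreal (e/2) + ennreal (e/2)"
      using U(4) V(4) by (intro add_mono) auto
    also have "\<dots> = ennreal e" using e by (simp flip: ennreal_plus)
    finally show ?thesis by simp
  qed
  then show "hausdorff_premeasure s \<delta> (A \<union> B) = 0" by (rule ennreal_eq_0_if_le_all)
qed

lemma diam_pow_antimono:
  assumes "0 \<le> t" "t \<le> s" "bounded U" "diameter U \<le> 1"
  shows "diam_pow s U \<le> diam_pow t U"
proof -
  have d: "0 \<le> diameter U" using assms(3) by (rule diameter_ge_0)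
  have "diameter U powr s \<le> diameter U powr t" if "t > 0"
    using d assms that by (intro powr_mono') auto
  moreover have "diameter U powr s \<le> 1"
    using d assms by (intro powr_le1) auto
  ultimately show ?thesis
    using assms by (auto simp: diam_pow_def intro: ennreal_leI)
qed

text \<open>
  Once the mesh is at most \<open>1\<close>, raising the exponent can only decrease each term of the sum.
\<close>

lemma hausdorff_measure_0_mono:
  assumes "hausdorff_measure t A = 0" "0 \<le> t" "t \<le> s"
  shows "hausdorff_measure s A = 0"
  unfolding hausdorff_measure_eq_0_iff
proof (intro allI impI)
  fix \<delta> :: real assume \<delta>: "\<delta> > 0"
  have "hausdorff_premeasure s \<delta> A \<le> ennreal e" if e: "e > 0" for e
  proof -
    have "hausdorff_premeasure t (min \<delta> 1) A < ennreal e"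
      using assms(1) \<delta> e unfolding hausdorff_measure_eq_0_iff by simp
    then obtain U where U: "A \<subseteq> (\<Union>i::nat. U i)" "\<And>i. bounded (U i)"
      "\<And>i. diameter (U i) \<le> min \<delta> 1" "(\<Sum>i. diam_pow t (U i)) < ennreal e"
      unfolding hausdorff_premeasure_less_iff by blast
    have "hausdorff_premeasure s \<delta> A \<le> (\<Sum>i. diam_pow s (U i))"
      using U by (intro hausdorff_premeasure_le) auto
    also have "\<dots> \<le> (\<Sum>i. diam_pow t (U i))"
      using U assms by (intro suminf_le diam_pow_antimono) auto
    finally show ?thesis using U(4) by simp
  qed
  then show "hausdorff_premeasure s \<delta> A = 0" by (rule ennreal_eq_0_if_le_all)
qed

text \<open>
  Restricting to rational exponents turns statements about the dimension into countable unions of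
  statements about null sets, which is what measurability of \<^const>\<open>level_dim\<close> needs.
\<close>

lemma hausdorff_dim_less_iff:
  "hausdorff_dim A < ereal d \<longleftrightarrow> (\<exists>t\<in>\<rat>. 0 < t \<and> t < d \<and> hausdorff_measure t A = 0)"
proof
  assume "hausdorff_dim A < ereal d"
  then obtain t where t: "0 \<le> t" "hausdorff_measure t A = 0" "t < d"
    unfolding hausdorff_dim_def INF_less_iff by auto
  then obtain q where q: "q \<in> \<rat>" "t < q" "q < d" using Rats_dense_in_real by blast
  then show "\<exists>t\<in>\<rat>. 0 < t \<and> t < d \<and> hausdorff_measure t A = 0"
    using hausdorff_measure_0_mono[OF t(2,1), of q] t by (intro bexI[of _ q]) auto
next
  assume "\<exists>t\<in>\<rat>. 0 < t \<and> t < d \<and> hausdorff_measure t A = 0"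
  then show "hausdorff_dim A < ereal d"
    unfolding hausdorff_dim_def INF_less_iff by (auto intro: less_imp_le)
qed

text \<open>
  A finite-scale witness of smallness. For \<open>s > 0\<close> a set has Hausdorff measure zero iff it is thin for
  every \<open>e\<close>, and since the cover is open, thinness at one fixed \<open>e\<close> survives small perturbations of a
  compact set. Using \<open>e\<close> both as a bound on the mesh and on the sum leaves a single parameter, so
  that nullity is a countable intersection of perturbation-stable conditions.
\<close>

definition open_thin :: "real \<Rightarrow> real \<Rightarrow> 'a::metric_space set \<Rightarrow> bool" where
  "open_thin s e A \<longleftrightarrow>
     (\<exists>U :: nat \<Rightarrow> 'a set. A \<subseteq> (\<Union>i. U i) \<and> (\<forall>i. open (U i) \<and> bounded (U i) \<and> diameter (U i) \<le> e) \<and>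
        (\<Sum>i. diam_pow s (U i)) \<le> ennreal e)"

lemma open_thin_mono: "open_thin s d A \<Longrightarrow> d \<le> e \<Longrightarrow> open_thin s e A"
  unfolding open_thin_def by (meson ennreal_leI order_trans)

lemma open_thin_subset: "open_thin s e B \<Longrightarrow> A \<subseteq> B \<Longrightarrow> open_thin s e A"
  unfolding open_thin_def by blast

text \<open>
  For \<open>s > 0\<close> the map \<open>d \<mapsto> d^s\<close> is continuous at the diameter of \<open>U\<close>, also when that diameter is
  \<open>0\<close>; a sufficiently thin open neighbourhood of \<open>U\<close> therefore costs hardly more than \<open>U\<close>.
\<close>

lemma open_enlargement:
  assumes s: "0 < s" and U: "bounded U" "diameter U < e" and t: "0 < t"
  obtains V where "open V" "U \<subseteq> V" "bounded V" "diameter V \<le> e" "diam_pow s V \<le> diam_pow s U + ennreal t"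
proof (cases "U = {}")
  case True
  show ?thesis
    by (rule that[of "{}"]) (use True U in \<open>auto simp: diam_pow_def\<close>)
next
  case False
  define d where "d = diameter U"
  have d0: "0 \<le> d" unfolding d_def using U(1) by (rule diameter_ge_0)
  have "((\<lambda>h. (d + 2*h) powr s) \<longlongrightarrow> (d + 2*0) powr s) (at_right 0)"
    using s d0 by (intro tendsto_powr' tendsto_intros) (auto intro!: eventually_at_rightI[of 0 1])
  then have "\<forall>\<^sub>F h in at_right 0. (d + 2*h) powr s < d powr s + t"
    using t by (intro order_tendstoD(2)) auto
  moreover have "\<forall>\<^sub>F h in at_right 0. h < (e - d)/2"
    using U(2) by (intro eventually_at_rightI[of 0 "(e - d)/2"]) (auto simp: d_def)
  moreover have "\<forall>\<^sub>F h::real in at_right 0. 0 < h"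
    by (simp add: eventually_at_right_less)
  ultimately have "\<forall>\<^sub>F h in at_right 0. (d + 2*h) powr s < d powr s + t \<and> h < (e - d)/2 \<and> 0 < h"
    by eventually_elim auto
  then obtain h where h: "(d + 2*h) powr s < d powr s + t" "h < (e - d)/2" "0 < h"
    using eventually_happens'[OF trivial_limit_at_right_real] by blast
  define V where "V = (\<Union>x\<in>U. ball x h)"
  have sub: "U \<subseteq> V" using h by (auto simp: V_def)
  have dist: "dist y z \<le> d + 2*h" if yz: "y \<in> V" "z \<in> V" for y z
  proof -
    obtain x x' where "x \<in> U" "y \<in> ball x h" "x' \<in> U" "z \<in> ball x' h"
      using yz unfolding V_def by blast
    then have x: "x \<in> U" "dist x y < h" "x' \<in> U" "dist x' z < h" by auto
    have "dist x x' \<le> d" unfolding d_def by (rule diameter_bounded_bound[OF U(1) x(1) x(3)])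
    moreover have "dist y z \<le> dist x y + dist x x' + dist x' z"
      using dist_triangle[of y z x] dist_triangle[of x z x'] by (simp add: dist_commute)
    ultimately show ?thesis using x by linarith
  qed
  have bV: "bounded V" using dist bounded_two_points by blast
  have dV: "diameter V \<le> d + 2*h"
    using False sub dist unfolding diameter_def by (auto intro!: cSUP_least)
  show ?thesis
  proof
    show "open V" by (auto simp: V_def)
    show "diameter V \<le> e" using dV h(2) by (simp add: field_simps)
    have "diameter V powr s \<le> (d + 2*h) powr s"
      using dV s diameter_ge_0[OF bV] by (intro powr_mono2) auto
    then have "diameter V powr s \<le> d powr s + t" using h by linarith
    then have "ennreal (diameter V powr s) \<le> ennreal (d powr s) + ennreal t"
      using t by (simp flip: ennreal_plus add: ennreal_leI)
    then show "diam_pow s V \<le> diam_pow s U + ennreal t"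
      using False sub s by (auto simp: diam_pow_def d_def)
  qed (use sub bV in auto)
qed

lemma hausdorff_measure_0_iff_open_thin:
  assumes s: "0 < s"
  shows "hausdorff_measure s A = 0 \<longleftrightarrow> (\<forall>e>0. open_thin s e A)"
proof
  assume null: "hausdorff_measure s A = 0"
  show "\<forall>e>0. open_thin s e A"
  proof (intro allI impI)
    fix e :: real assume e: "e > 0"
    have "hausdorff_premeasure s (e/2) A < ennreal (e/2)"
      using null e unfolding hausdorff_measure_eq_0_iff by simp
    then obtain U where U: "A \<subseteq> (\<Union>i::nat. U i)" "\<And>i. bounded (U i)"
      "\<And>i. diameter (U i) \<le> e/2" "(\<Sum>i. diam_pow s (U i)) < ennreal (e/2)"
      unfolding hausdorff_premeasure_less_iff by blast
    define t where "t i = e/2 * (1/2)^Suc i" for i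
    have "t sums (e/2 * 1)" unfolding t_def by (intro sums_mult power_half_series)
    moreover have "0 \<le> t i" for i using e by (simp add: t_def)
    ultimately have t_sum: "(\<Sum>i. ennreal (t i)) = ennreal (e/2)"
      by (metis suminf_ennreal_eq mult.right_neutral)
    have "\<exists>V. open V \<and> U i \<subseteq> V \<and> bounded V \<and> diameter V \<le> e \<and>
        diam_pow s V \<le> diam_pow s (U i) + ennreal (t i)" for i
    proof -
      have "diameter (U i) < e" using U(3)[of i] e by linarith
      moreover have "0 < t i" using e by (simp add: t_def)
      ultimately show ?thesis using open_enlargement[OF s U(2)[of i]] by metis
    qed
    then obtain V where V: "\<And>i. open (V i)" "\<And>i. U i \<subseteq> V i" "\<And>i. bounded (V i)"
      "\<And>i. diameter (V i) \<le> e" "\<And>i. diam_pow s (V i) \<le> diam_pow s (U i) + ennreal (t i)"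
      by metis
    have "(\<Sum>i. diam_pow s (V i)) \<le> (\<Sum>i. diam_pow s (U i) + ennreal (t i))"
      using V(5) by (intro suminf_le) auto
    also have "\<dots> = (\<Sum>i. diam_pow s (U i)) + ennreal (e/2)"
      by (subst suminf_add[symmetric]) (auto simp: t_sum)
    also have "\<dots> \<le> ennreal (e/2) + ennreal (e/2)"
      using U(4) by (intro add_mono) auto
    also have "\<dots> = ennreal e" using e by (simp flip: ennreal_plus)
    finally have "(\<Sum>i. diam_pow s (V i)) \<le> ennreal e" .
    moreover have "A \<subseteq> (\<Union>i. V i)" using U(1) V(2) by blast
    ultimately show "open_thin s e A" unfolding open_thin_def using V by blast
  qed
next
  assume thin: "\<forall>e>0. open_thin s e A"
  show "hausdorff_measure s A = 0"
    unfolding hausdorff_measure_eq_0_iff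
  proof (intro allI impI)
    fix \<delta> :: real assume \<delta>: "\<delta> > 0"
    have "hausdorff_premeasure s \<delta> A \<le> ennreal e" if e: "e > 0" for e
    proof -
      have "open_thin s (min e \<delta>) A" using thin e \<delta> by simp
      then obtain U :: "nat \<Rightarrow> 'a set" where U: "A \<subseteq> (\<Union>i. U i)" "\<And>i. bounded (U i)"
        "\<And>i. diameter (U i) \<le> min e \<delta>" "(\<Sum>i. diam_pow s (U i)) \<le> ennreal (min e \<delta>)"
        unfolding open_thin_def by blast
      have "hausdorff_premeasure s \<delta> A \<le> (\<Sum>i. diam_pow s (U i))"
        using U by (intro hausdorff_premeasure_le) auto
      also have "\<dots> \<le> ennreal e" using U(4) by (rule order_trans) (simp add: ennreal_leI)
      finally show ?thesis by simp
    qed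
    then show "hausdorff_premeasure s \<delta> A = 0" by (rule ennreal_eq_0_if_le_all)
  qed
qed

section \<open>Stability and measurability of level sets\<close>

text \<open>
  An open cover \<open>V\<close> of the level set of \<open>f\<close> at \<open>r\<close> leaves a compact remainder \<open>F - V\<close> on which
  \<open>\<bar>f - r\<bar>\<close> is bounded below. Functions close to \<open>f\<close> cannot take values close to \<open>r\<close> there, so
  their level sets are still contained in \<open>V\<close>. Letting the level and the function vary at once yields
  both measurability in \<open>r\<close> and openness in \<open>f\<close>.
\<close>

lemma open_thin_levels_stable:
  fixes f :: "'a::metric_space \<Rightarrow> real"
  assumes F: "compact F" and f: "continuous_on F f" and thin: "open_thin s e {x \<in> F. f x = r}"
  shows "\<exists>\<delta>>0. \<forall>g r'. (\<forall>x\<in>F. \<bar>g x - f x\<bar> < \<delta>) \<longrightarrow> \<bar>r' - r\<bar> < \<delta> \<longrightarrow> open_thin s e {x \<in> F. g x = r'}"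
proof -
  obtain U :: "nat \<Rightarrow> 'a set" where U: "{x \<in> F. f x = r} \<subseteq> (\<Union>i. U i)" "\<And>i. open (U i)"
    and thin_V: "open_thin s e (\<Union>i. U i)"
    using thin unfolding open_thin_def by blast
  define K where "K = F - (\<Union>i. U i)"
  have K: "compact K" unfolding K_def using F U(2) by (intro compact_diff) auto
  obtain m where m: "0 < m" "\<And>x. x \<in> K \<Longrightarrow> m \<le> \<bar>f x - r\<bar>"
  proof (cases "K = {}")
    case False
    have "continuous_on K (\<lambda>x. \<bar>f x - r\<bar>)"
      using f by (intro continuous_intros) (auto simp: K_def intro: continuous_on_subset)
    then obtain x0 where x0: "x0 \<in> K" "\<And>x. x \<in> K \<Longrightarrow> \<bar>f x0 - r\<bar> \<le> \<bar>f x - r\<bar>"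
      using continuous_attains_inf[OF K False] by blast
    have "f x0 \<noteq> r" using x0(1) U(1) by (auto simp: K_def)
    then show ?thesis using x0(2) that[of "\<bar>f x0 - r\<bar>"] by auto
  qed (use that[of 1] in auto)
  show ?thesis
  proof (intro exI[of _ "m/2"] conjI allI impI)
    show "0 < m/2" using m by simp
    fix g :: "'a \<Rightarrow> real" and r'
    assume g: "\<forall>x\<in>F. \<bar>g x - f x\<bar> < m/2" and r': "\<bar>r' - r\<bar> < m/2"
    have "{x \<in> F. g x = r'} \<subseteq> (\<Union>i. U i)"
    proof (rule ccontr)
      assume "\<not> {x \<in> F. g x = r'} \<subseteq> (\<Union>i. U i)"
      then obtain x where x: "x \<in> F" "g x = r'" "x \<in> K" by (auto simp: K_def)
      show False using bspec[OF g x(1)] r' m(2)[OF x(3)] x(2) by linarith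
    qed
    then show "open_thin s e {x \<in> F. g x = r'}"
      using thin_V open_thin_subset by blast
  qed
qed

lemma open_levels_open_thin:
  fixes f :: "'a::metric_space \<Rightarrow> real"
  assumes F: "compact F" and f: "continuous_on F f"
  shows "open {r. open_thin s e {x \<in> F. f x = r}}"
  unfolding open_dist
proof safe
  fix r assume "open_thin s e {x \<in> F. f x = r}"
  from open_thin_levels_stable[OF F f this] obtain \<delta> where \<delta>: "0 < \<delta>"
    "\<forall>g r'. (\<forall>x\<in>F. \<bar>g x - f x\<bar> < \<delta>) \<longrightarrow> \<bar>r' - r\<bar> < \<delta> \<longrightarrow> open_thin s e {x \<in> F. g x = r'}"
    by blast
  show "\<exists>\<delta>>0. \<forall>r'. dist r' r < \<delta> \<longrightarrow> r' \<in> {r. open_thin s e {x \<in> F. f x = r}}"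
    using \<delta>(1) spec[OF \<delta>(2), of f] by (auto simp: dist_real_def)
qed

lemma hausdorff_measure_0_iff_open_thin_nat:
  assumes "0 < s"
  shows "hausdorff_measure s A = 0 \<longleftrightarrow> (\<forall>n. open_thin s (inverse (Suc n)) A)"
proof
  assume "\<forall>n. open_thin s (inverse (Suc n)) A"
  then have "open_thin s e A" if "0 < e" for e
    using reals_Archimedean[OF that] open_thin_mono less_imp_le by metis
  then show "hausdorff_measure s A = 0"
    using hausdorff_measure_0_iff_open_thin[OF assms] by blast
next
  assume "hausdorff_measure s A = 0"
  then have "open_thin s e A" if "0 < e" for e
    using hausdorff_measure_0_iff_open_thin[OF assms] that by blast
  then show "\<forall>n. open_thin s (inverse (Suc n)) A" by simp
qed

lemma borel_null_levels:
  fixes f :: "'a::metric_space \<Rightarrow> real"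
  assumes "compact F" "continuous_on F f" "0 < s"
  shows "{r. hausdorff_measure s {x \<in> F. f x = r} = 0} \<in> sets borel"
proof -
  have "{r. hausdorff_measure s {x \<in> F. f x = r} = 0} =
      (\<Inter>n. {r. open_thin s (inverse (Suc n)) {x \<in> F. f x = r}})"
    using hausdorff_measure_0_iff_open_thin_nat[OF assms(3)] by auto
  also have "\<dots> \<in> sets borel"
    using open_levels_open_thin[OF assms(1,2)] by (intro sets.countable_INT) auto
  finally show ?thesis .
qed

lemma borel_level_dim_ge:
  fixes f :: "'a::metric_space \<Rightarrow> real"
  assumes "compact F" "continuous_on F f"
  shows "{r. ereal d \<le> level_dim f r F} \<in> sets borel"
proof -
  have "{r. ereal d \<le> level_dim f r F} =
      - (\<Union>t\<in>{t\<in>\<rat>. 0 < t \<and> t < d}. {r. hausdorff_measure t {x \<in> F. f x = r} = 0})"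
    using hausdorff_dim_less_iff by (fastforce simp: level_dim_def not_less[symmetric])
  also have "\<dots> \<in> sets borel"
  proof (intro borel_comp sets.countable_UN'')
    show "countable {t \<in> \<rat>. 0 < t \<and> t < d}"
      by (rule countable_subset[OF _ countable_rat]) auto
  qed (use borel_null_levels[OF assms] in auto)
  finally show ?thesis .
qed

section \<open>Functions whose levels are almost all null\<close>

text \<open>
  For continuous \<open>f\<close> on a compact \<open>F\<close> and \<open>s \<ge> 0\<close> this property lies between \<open>Dstar_fun f F < s\<close> and
  \<open>Dstar_fun f F \<le> s\<close>. It replaces these inequalities because it passes to functions assembled from
  others by lattice operations, and because it is a countable conjunction of stable conditions.
\<close>

definition null_levels :: "real \<Rightarrow> 'a::metric_space set \<Rightarrow> ('a \<Rightarrow> real) \<Rightarrow> bool" where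
  "null_levels s F f \<longleftrightarrow> negligible {r. hausdorff_measure s {x \<in> F. f x = r} \<noteq> 0}"

lemma Dstar_fun_nonneg: "0 \<le> Dstar_fun f F"
proof -
  have "0 \<le> level_dim f r F" for r
    unfolding level_dim_def hausdorff_dim_def by (auto intro: INF_greatest)
  then have "{r. ereal 0 \<le> level_dim f r F} = UNIV" by (auto simp: zero_ereal_def)
  then have "ereal 0 \<le> Dstar_fun f F"
    unfolding Dstar_fun_def by (intro SUP_upper) auto
  then show ?thesis by (simp add: zero_ereal_def)
qed

text \<open>
  The value \<open>0\<close> of \<^const>\<open>emeasure\<close> says nothing about a non-measurable set, so the passage from
  \<^const>\<open>Dstar_fun\<close> to almost every level depends on the measurability of the level dimension.
\<close>

lemma Dstar_fun_less_imp_null_levels: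
  fixes f :: "'a::metric_space \<Rightarrow> real"
  assumes F: "compact F" and f: "continuous_on F f" and less: "Dstar_fun f F < ereal s"
  shows "null_levels s F f"
proof -
  obtain d where d: "Dstar_fun f F < ereal d" "ereal d < ereal s"
    using ereal_dense2[OF less] by blast
  have "\<not> 0 < emeasure lebesgue {r. ereal d \<le> level_dim f r F}"
  proof
    assume "0 < emeasure lebesgue {r. ereal d \<le> level_dim f r F}"
    then have "ereal d \<le> Dstar_fun f F"
      unfolding Dstar_fun_def by (intro SUP_upper) auto
    then show False using d(1) by simp
  qed
  then have "{r. ereal d \<le> level_dim f r F} \<in> null_sets lebesgue"
    using borel_level_dim_ge[OF F f, of d] by (auto simp: null_sets_def)
  moreover have "hausdorff_measure s {x \<in> F. f x = r} = 0" if "\<not> ereal d \<le> level_dim f r F" for r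
  proof -
    have "hausdorff_dim {x \<in> F. f x = r} < ereal d"
      using that by (simp add: level_dim_def not_le)
    then obtain t where "0 < t" "t < d" "hausdorff_measure t {x \<in> F. f x = r} = 0"
      unfolding hausdorff_dim_less_iff by blast
    then show ?thesis using hausdorff_measure_0_mono[of t _ s] d(2) by auto
  qed
  then have "{r. hausdorff_measure s {x \<in> F. f x = r} \<noteq> 0} \<subseteq> {r. ereal d \<le> level_dim f r F}"
    by blast
  ultimately show ?thesis
    unfolding null_levels_def negligible_iff_null_sets[symmetric] by (rule negligible_subset)
qed

lemma null_levels_imp_Dstar_fun_le:
  assumes "0 \<le> s" "null_levels s F f"
  shows "Dstar_fun f F \<le> ereal s"
  unfolding Dstar_fun_def
proof (rule SUP_least)
  fix d assume "d \<in> {d. 0 < emeasure lebesgue {r. ereal d \<le> level_dim f r F}}"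
  then have d: "emeasure lebesgue {r. ereal d \<le> level_dim f r F} \<noteq> 0" by simp
  show "ereal d \<le> ereal s"
  proof (rule ccontr)
    assume less: "\<not> ereal d \<le> ereal s"
    have "hausdorff_measure s {x \<in> F. f x = r} \<noteq> 0" if r: "ereal d \<le> level_dim f r F" for r
    proof
      assume "hausdorff_measure s {x \<in> F. f x = r} = 0"
      then have "level_dim f r F \<le> ereal s"
        unfolding level_dim_def hausdorff_dim_def using assms(1) by (intro INF_lower) auto
      then show False using r less by order
    qed
    then have "{r. ereal d \<le> level_dim f r F} \<subseteq> {r. hausdorff_measure s {x \<in> F. f x = r} \<noteq> 0}"
      by blast
    with assms(2) have "{r. ereal d \<le> level_dim f r F} \<in> null_sets lebesgue"
      unfolding null_levels_def negligible_iff_null_sets[symmetric] by (rule negligible_subset)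
    then show False using d by (auto simp: null_sets_def)
  qed
qed

lemma negligible_reflect:
  assumes "negligible (S :: real set)"
  shows "negligible ((\<lambda>r. c - r) ` S)"
proof -
  have "negligible ((+) c ` (uminus ` S))"
    using assms by (intro negligible_translation negligible_differentiable_image_negligible)
      (auto intro!: derivative_intros)
  then show ?thesis by (simp add: image_image)
qed

text \<open>
  The common reason why maxima, minima and unfolded functions inherit the property; the exceptional
  set \<open>N\<close> leaves room for the level of a plateau introduced by the construction.
\<close>

lemma null_levels_cover:
  assumes f: "null_levels s F f" and g: "null_levels s F g" and N: "negligible N"
    and sub: "\<And>r. r \<notin> N \<Longrightarrow> {x \<in> F. h x = r} \<subseteq> {x \<in> F. f x = r} \<union> {x \<in> F. g x = r}"
  shows "null_levels s F h"
proof -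
  have "{r. hausdorff_measure s {x \<in> F. h x = r} \<noteq> 0} \<subseteq>
      N \<union> {r. hausdorff_measure s {x \<in> F. f x = r} \<noteq> 0}
        \<union> {r. hausdorff_measure s {x \<in> F. g x = r} \<noteq> 0}"
    using hausdorff_measure_0_subset[OF hausdorff_measure_0_Un sub] by blast
  then show ?thesis
    using f g N unfolding null_levels_def by (meson negligible_Un negligible_subset)
qed

lemma open_thin_empty: "0 < e \<Longrightarrow> open_thin s e {}"
  unfolding open_thin_def by (intro exI[of _ "\<lambda>_. {}"]) (auto simp: diam_pow_def)

lemma hausdorff_measure_empty: "0 < s \<Longrightarrow> hausdorff_measure s {} = 0"
  using hausdorff_measure_0_iff_open_thin open_thin_empty by blast

lemma null_levels_const: "0 < s \<Longrightarrow> (\<And>x. x \<in> F \<Longrightarrow> f x = c) \<Longrightarrow> null_levels s F f"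
proof -
  assume s: "0 < s" and f: "\<And>x. x \<in> F \<Longrightarrow> f x = c"
  have "{x \<in> F. f x = r} = {}" if "r \<noteq> c" for r using f that by auto
  then have "{r. hausdorff_measure s {x \<in> F. f x = r} \<noteq> 0} \<subseteq> {c}"
    using hausdorff_measure_empty[OF s] by fastforce
  then show ?thesis unfolding null_levels_def using negligible_sing negligible_subset by blast
qed

lemma null_levels_reflect:
  assumes f: "null_levels s F f" and g: "\<And>x. x \<in> F \<Longrightarrow> g x = c - f x"
  shows "null_levels s F g"
proof -
  have "{x \<in> F. g x = r} = {x \<in> F. f x = c - r}" for r using g by auto
  then have "{r. hausdorff_measure s {x \<in> F. g x = r} \<noteq> 0} \<subseteq>
      (\<lambda>r. c - r) ` {r. hausdorff_measure s {x \<in> F. f x = r} \<noteq> 0}"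
    by (auto intro: image_eqI[of _ _ "c - _"])
  then show ?thesis
    using f negligible_reflect negligible_subset unfolding null_levels_def by blast
qed

section \<open>Lattice approximation and subadditivity of powers\<close>

text \<open>
  A Dini argument: by compactness finitely many members of the family suffice to stay below \<open>u\<close>, and
  directedness provides a single member below all of these.
\<close>

lemma directed_family_below:
  fixes S :: "('a::metric_space \<Rightarrow> real) set"
  assumes F: "compact F" "F \<noteq> {}" and S: "\<And>g. g \<in> S \<Longrightarrow> continuous_on F g"
    and directed: "\<And>g h. g \<in> S \<Longrightarrow> h \<in> S \<Longrightarrow> \<exists>k\<in>S. \<forall>z\<in>F. k z \<le> g z \<and> k z \<le> h z"
    and u: "continuous_on F u" and below: "\<And>y. y \<in> F \<Longrightarrow> \<exists>g\<in>S. g y < u y"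
  shows "\<exists>g\<in>S. \<forall>z\<in>F. g z < u z"
proof -
  have "\<exists>T. open T \<and> T \<inter> F = {z \<in> F. g z < u z}" if "g \<in> S" for g
  proof -
    have "continuous_on F (\<lambda>z. u z - g z)" using u S[OF that] by (intro continuous_intros)
    then have "\<exists>T. open T \<and> T \<inter> F = (\<lambda>z. u z - g z) -` {0<..} \<inter> F"
      unfolding continuous_on_open_invariant using open_greaterThan by blast
    moreover have "(\<lambda>z. u z - g z) -` {0<..} \<inter> F = {z \<in> F. g z < u z}" by auto
    ultimately show ?thesis by simp
  qed
  then obtain T where T: "\<And>g. g \<in> S \<Longrightarrow> open (T g)"
    "\<And>g. g \<in> S \<Longrightarrow> T g \<inter> F = {z \<in> F. g z < u z}" by metis
  have "F \<subseteq> (\<Union>g\<in>S. T g)" using below T(2) by blast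
  then obtain D where D: "D \<subseteq> S" "finite D" "F \<subseteq> (\<Union>g\<in>D. T g)"
    using compactE_image[OF F(1), of S T] T(1) by metis
  have "\<exists>k\<in>S. \<forall>g\<in>D'. \<forall>z\<in>F. k z \<le> g z" if "finite D'" "D' \<subseteq> S" for D'
    using that
  proof (induction D' rule: finite_induct)
    case empty
    then show ?case using F(2) below by blast
  next
    case (insert g D')
    then obtain k where k: "k \<in> S" "\<forall>g\<in>D'. \<forall>z\<in>F. k z \<le> g z" by auto
    obtain k' where k': "k' \<in> S" "\<forall>z\<in>F. k' z \<le> g z \<and> k' z \<le> k z"
      using directed[of g k] insert.prems k(1) by auto
    then show ?case using k(2) by (intro bexI[of _ k']) (auto intro: order_trans)
  qed
  from this[OF D(2,1)] obtain k where k: "k \<in> S" "\<forall>g\<in>D. \<forall>z\<in>F. k z \<le> g z" by blast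
  have "k z < u z" if z: "z \<in> F" for z
  proof -
    obtain g where g: "g \<in> D" "z \<in> T g" using D(3) z by blast
    then have "g z < u z" using T(2)[of g] D(1) z by auto
    then show ?thesis using k(2) g(1) z by (meson le_less_trans)
  qed
  then show ?thesis using k(1) by blast
qed

text \<open>
  The lattice form of the Stone-Weierstrass theorem. Fixing \<open>x\<close>, minima of members that are large at
  \<open>x\<close> produce one that is below \<open>f + e\<close> everywhere; maxima of those, over all \<open>x\<close>, are in addition
  above \<open>f - e\<close>. The second step is the first one applied to the negated family. Only one-sided
  conditions at the two points are required, which avoids truncating the interpolating functions.
\<close>

lemma lattice_uniform_approximation:
  fixes S :: "('a::metric_space \<Rightarrow> real) set"
  assumes F: "compact F" "F \<noteq> {}" and S: "\<And>g. g \<in> S \<Longrightarrow> continuous_on F g"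
    and mins: "\<And>g h. g \<in> S \<Longrightarrow> h \<in> S \<Longrightarrow> \<exists>k\<in>S. \<forall>z\<in>F. k z = min (g z) (h z)"
    and maxs: "\<And>g h. g \<in> S \<Longrightarrow> h \<in> S \<Longrightarrow> \<exists>k\<in>S. \<forall>z\<in>F. k z = max (g z) (h z)"
    and f: "continuous_on F f"
    and two_points: "\<And>x y. x \<in> F \<Longrightarrow> y \<in> F \<Longrightarrow> \<exists>g\<in>S. f x - e < g x \<and> g y < f y + e"
  shows "\<exists>g\<in>S. \<forall>z\<in>F. \<bar>f z - g z\<bar> < e"
proof -
  define B where "B = {g \<in> S. \<forall>z\<in>F. g z < f z + e}"
  have "\<exists>g\<in>B. f x - e < g x" if x: "x \<in> F" for x
  proof -
    define A where "A = {g \<in> S. f x - e < g x}"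
    have "\<exists>g\<in>A. \<forall>z\<in>F. g z < f z + e"
    proof (rule directed_family_below[OF F])
      show "continuous_on F (\<lambda>z. f z + e)" using f by (intro continuous_intros)
      fix g h assume "g \<in> A" "h \<in> A"
      then show "\<exists>k\<in>A. \<forall>z\<in>F. k z \<le> g z \<and> k z \<le> h z"
        using mins[of g h] x by (force simp: A_def)
    qed (use S two_points[OF x] in \<open>auto simp: A_def\<close>)
    then show ?thesis by (auto simp: A_def B_def)
  qed
  then have above: "\<exists>g\<in>B. - g x < - f x + e" if "x \<in> F" for x using that by force
  define B' where "B' = (\<lambda>g z. - g z) ` B"
  have "\<exists>g\<in>B'. \<forall>z\<in>F. g z < - f z + e"
  proof (rule directed_family_below[OF F])
    show "continuous_on F (\<lambda>z. - f z + e)" using f by (intro continuous_intros)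
    show "continuous_on F g" if "g \<in> B'" for g
      using that S by (auto simp: B'_def B_def intro: continuous_intros)
    fix g' h' assume "g' \<in> B'" "h' \<in> B'"
    then obtain g h where gh: "g \<in> B" "h \<in> B" "g' = (\<lambda>z. - g z)" "h' = (\<lambda>z. - h z)"
      by (auto simp: B'_def)
    then obtain k where k: "k \<in> S" "\<forall>z\<in>F. k z = max (g z) (h z)"
      using maxs[of g h] by (auto simp: B_def)
    then have "k \<in> B" using gh(1,2) by (auto simp: B_def)
    then show "\<exists>k\<in>B'. \<forall>z\<in>F. k z \<le> g' z \<and> k z \<le> h' z"
      using k(2) gh(3,4) by (intro bexI[of _ "\<lambda>z. - k z"]) (auto simp: B'_def)
  qed (use above in \<open>auto simp: B'_def\<close>)
  then obtain g where "g \<in> B" "\<forall>z\<in>F. - g z < - f z + e" by (auto simp: B'_def)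
  then show ?thesis by (intro bexI[of _ g]) (force simp: B_def abs_less_iff)+
qed

text \<open>
  With \<open>t = a + b\<close>, both \<open>a/t\<close> and \<open>b/t\<close> lie in the unit interval, where \<open>c \<le> c powr \<alpha>\<close>.
\<close>

lemma powr_subadditive:
  fixes a b \<alpha> :: real
  assumes "0 \<le> a" "0 \<le> b" "0 < \<alpha>" "\<alpha> \<le> 1"
  shows "(a + b) powr \<alpha> \<le> a powr \<alpha> + b powr \<alpha>"
proof (cases "a + b = 0")
  case True
  then show ?thesis using assms by (simp add: add_nonneg_eq_0_iff)
next
  case False
  define t where "t = a + b"
  have t: "0 < t" using False assms by (simp add: t_def)
  have le: "c / t \<le> (c / t) powr \<alpha>" if "0 \<le> c" "c \<le> t" for c
    using powr_mono'[of \<alpha> 1 "c/t"] that t assms by (auto simp: field_simps)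
  have "1 = a / t + b / t" using t by (simp add: t_def add_divide_distrib[symmetric])
  also have "\<dots> \<le> (a / t) powr \<alpha> + (b / t) powr \<alpha>"
    using assms by (intro add_mono le) (auto simp: t_def)
  also have "\<dots> = (a powr \<alpha> + b powr \<alpha>) / t powr \<alpha>"
    using assms t by (simp add: powr_divide add_divide_distrib)
  finally show ?thesis using t by (simp add: field_simps t_def)
qed

section \<open>The space of 1-Hoelder functions as a Baire space\<close>

locale holder_space =
  fixes \<alpha> :: real and F :: "'a::metric_space set"
  assumes alpha_pos: "0 < \<alpha>" and alpha_le_1: "\<alpha> \<le> 1" and compact_F: "compact F"
begin

sublocale Metric_space "holder1 \<alpha> F" "holder1_dist \<alpha> F"
  by (rule Metric_space_holder1[OF compact_F alpha_pos])

lemma holder1_topology_eq: "holder1_topology \<alpha> F = mtopology"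
  by (simp add: holder1_topology_def)

lemma topspace_holder1 [simp]: "topspace (holder1_topology \<alpha> F) = holder1 \<alpha> F"
  by (simp add: holder1_topology_eq)

lemma abs_diff_le_holder1_dist:
  assumes "f \<in> holder1 \<alpha> F" "g \<in> holder1 \<alpha> F" "x \<in> F"
  shows "\<bar>f x - g x\<bar> \<le> holder1_dist \<alpha> F f g"
  using assms holder1_diff_bdd_above[OF compact_F alpha_pos assms(1,2)]
  by (auto simp: holder1_dist_def intro: cSUP_upper)

lemma holder1_dist_le:
  assumes "0 \<le> e" "\<And>x. x \<in> F \<Longrightarrow> \<bar>f x - g x\<bar> \<le> e"
  shows "holder1_dist \<alpha> F f g \<le> e"
  using assms by (auto simp: holder1_dist_def intro: cSUP_least)

text \<open>
  Pointwise estimates on \<open>F\<close> describe the topology without the supremum. For empty \<open>F\<close> they hold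
  vacuously and the distance is constantly \<open>0\<close>, so this case fits in.
\<close>

lemma openin_holder1_iff:
  "openin (holder1_topology \<alpha> F) U \<longleftrightarrow> U \<subseteq> holder1 \<alpha> F \<and>
     (\<forall>f\<in>U. \<exists>e>0. \<forall>g\<in>holder1 \<alpha> F. (\<forall>x\<in>F. \<bar>f x - g x\<bar> < e) \<longrightarrow> g \<in> U)"
proof (intro iffI conjI ballI)
  assume U: "openin (holder1_topology \<alpha> F) U"
  then show sub: "U \<subseteq> holder1 \<alpha> F" by (metis openin_subset topspace_holder1)
  fix f assume f: "f \<in> U"
  then obtain r where r: "r > 0" "mball f r \<subseteq> U"
    using U unfolding holder1_topology_eq openin_mtopology by blast
  have "g \<in> U" if g: "g \<in> holder1 \<alpha> F" "\<forall>x\<in>F. \<bar>f x - g x\<bar> < r/2" for g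
  proof -
    have "holder1_dist \<alpha> F f g \<le> r/2" using g r(1) by (intro holder1_dist_le) auto
    then have "g \<in> mball f r" using g(1) f sub r(1) by auto
    then show ?thesis using r(2) by blast
  qed
  then show "\<exists>e>0. \<forall>g\<in>holder1 \<alpha> F. (\<forall>x\<in>F. \<bar>f x - g x\<bar> < e) \<longrightarrow> g \<in> U"
    using r(1) by (intro exI[of _ "r/2"]) auto
next
  assume U: "U \<subseteq> holder1 \<alpha> F \<and>
     (\<forall>f\<in>U. \<exists>e>0. \<forall>g\<in>holder1 \<alpha> F. (\<forall>x\<in>F. \<bar>f x - g x\<bar> < e) \<longrightarrow> g \<in> U)"
  show "openin (holder1_topology \<alpha> F) U"
    unfolding holder1_topology_eq openin_mtopology
  proof (intro conjI allI impI)
    fix f assume f: "f \<in> U"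
    then obtain e where e: "e > 0" "\<And>g. g \<in> holder1 \<alpha> F \<Longrightarrow> (\<And>x. x \<in> F \<Longrightarrow> \<bar>f x - g x\<bar> < e) \<Longrightarrow> g \<in> U"
      using U by blast
    have "g \<in> U" if g: "g \<in> mball f e" for g
    proof (rule e(2))
      show "g \<in> holder1 \<alpha> F" using g by auto
      fix x assume "x \<in> F"
      then show "\<bar>f x - g x\<bar> < e" using abs_diff_le_holder1_dist[of f g x] g by auto
    qed
    then show "\<exists>r>0. mball f r \<subseteq> U" using e(1) by blast
  qed (use U in auto)
qed

lemma closure_of_holder1_iff:
  assumes "S \<subseteq> holder1 \<alpha> F"
  shows "f \<in> holder1_topology \<alpha> F closure_of S \<longleftrightarrow>
    f \<in> holder1 \<alpha> F \<and> (\<forall>e>0. \<exists>g\<in>S. \<forall>x\<in>F. \<bar>f x - g x\<bar> < e)"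
proof (intro iffI conjI allI impI)
  assume f: "f \<in> holder1_topology \<alpha> F closure_of S"
  then show fC: "f \<in> holder1 \<alpha> F" by (auto simp: holder1_topology_eq metric_closure_of)
  fix e :: real assume "e > 0"
  then obtain g where g: "g \<in> S" "holder1_dist \<alpha> F f g < e"
    using f unfolding holder1_topology_eq metric_closure_of by auto
  have "\<bar>f x - g x\<bar> < e" if "x \<in> F" for x
    using abs_diff_le_holder1_dist[of f g x] fC g assms that by auto
  then show "\<exists>g\<in>S. \<forall>x\<in>F. \<bar>f x - g x\<bar> < e" using g(1) by blast
next
  assume f: "f \<in> holder1 \<alpha> F \<and> (\<forall>e>0. \<exists>g\<in>S. \<forall>x\<in>F. \<bar>f x - g x\<bar> < e)"
  have "\<exists>g\<in>S. g \<in> mball f e" if e: "e > 0" for e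
  proof -
    obtain g where g: "g \<in> S" "\<forall>x\<in>F. \<bar>f x - g x\<bar> < e/2" using f e half_gt_zero by blast
    then have "holder1_dist \<alpha> F f g \<le> e/2" using e by (intro holder1_dist_le) auto
    then have "g \<in> mball f e" using f g(1) assms e by auto
    then show ?thesis using g(1) by blast
  qed
  then show "f \<in> holder1_topology \<alpha> F closure_of S"
    using f by (auto simp: holder1_topology_eq metric_closure_of)
qed

lemma continuous_on_holder1:
  assumes "f \<in> holder1 \<alpha> F"
  shows "continuous_on F f"
  unfolding continuous_on_iff dist_real_def
proof (intro ballI allI impI)
  fix x and e :: real assume x: "x \<in> F" and "0 < e"
  show "\<exists>d>0. \<forall>y\<in>F. dist y x < d \<longrightarrow> \<bar>f y - f x\<bar> < e"
  proof (intro exI[of _ "e powr (1/\<alpha>)"] conjI ballI impI)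
    fix y assume y: "y \<in> F" "dist y x < e powr (1/\<alpha>)"
    have "dist y x powr \<alpha> < (e powr (1/\<alpha>)) powr \<alpha>"
      using y alpha_pos by (intro powr_less_mono2) auto
    also have "\<dots> = e" using \<open>0 < e\<close> alpha_pos by (simp add: powr_powr)
    finally show "\<bar>f y - f x\<bar> < e"
      using assms x y unfolding holder1_def by force
  qed (use \<open>0 < e\<close> in auto)
qed

lemma mcomplete_holder1: "mcomplete"
  unfolding mcomplete_def
proof (intro allI impI)
  fix \<sigma> assume "MCauchy \<sigma>"
  then have \<sigma>: "\<And>n. \<sigma> n \<in> holder1 \<alpha> F"
    and cauchy: "\<And>e. e > 0 \<Longrightarrow> \<exists>N. \<forall>m n. N \<le> m \<longrightarrow> N \<le> n \<longrightarrow> holder1_dist \<alpha> F (\<sigma> m) (\<sigma> n) < e"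
    unfolding MCauchy_def by auto
  have "Cauchy (\<lambda>n. \<sigma> n x)" if x: "x \<in> F" for x
    unfolding Cauchy_def dist_real_def
  proof (intro allI impI)
    fix e :: real assume "e > 0"
    then obtain N where "\<forall>m n. N \<le> m \<longrightarrow> N \<le> n \<longrightarrow> holder1_dist \<alpha> F (\<sigma> m) (\<sigma> n) < e"
      using cauchy by blast
    then show "\<exists>N. \<forall>m\<ge>N. \<forall>n\<ge>N. \<bar>\<sigma> m x - \<sigma> n x\<bar> < e"
      using abs_diff_le_holder1_dist[OF \<sigma> \<sigma> x] by (meson le_less_trans)
  qed
  then obtain l where l: "\<And>x. x \<in> F \<Longrightarrow> (\<lambda>n. \<sigma> n x) \<longlonglongrightarrow> l x"
    unfolding Cauchy_convergent_iff convergent_def by metis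
  define f where "f = restrict l F"
  have fC: "f \<in> holder1 \<alpha> F"
    unfolding holder1_def
  proof (intro CollectI conjI ballI)
    fix x y assume x: "x \<in> F" "y \<in> F"
    have "(\<lambda>n. \<bar>\<sigma> n x - \<sigma> n y\<bar>) \<longlonglongrightarrow> \<bar>l x - l y\<bar>"
      using x by (intro tendsto_intros l)
    moreover have "\<bar>\<sigma> n x - \<sigma> n y\<bar> \<le> dist x y powr \<alpha>" for n
      using \<sigma>[of n] x by (auto simp: holder1_def)
    ultimately have "\<bar>l x - l y\<bar> \<le> dist x y powr \<alpha>"
      by (intro LIMSEQ_le_const2) auto
    then show "\<bar>f x - f y\<bar> \<le> dist x y powr \<alpha>" using x by (simp add: f_def)
  qed (simp add: f_def)
  have "\<exists>N. \<forall>n\<ge>N. holder1_dist \<alpha> F (\<sigma> n) f < e" if e: "e > 0" for e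
  proof -
    obtain N where N: "\<And>m n. N \<le> m \<Longrightarrow> N \<le> n \<Longrightarrow> holder1_dist \<alpha> F (\<sigma> m) (\<sigma> n) < e/2"
      using cauchy half_gt_zero[OF e] by blast
    have "holder1_dist \<alpha> F (\<sigma> n) f \<le> e/2" if n: "n \<ge> N" for n
    proof (rule holder1_dist_le)
      fix x assume x: "x \<in> F"
      have "(\<lambda>m. \<bar>\<sigma> n x - \<sigma> m x\<bar>) \<longlonglongrightarrow> \<bar>\<sigma> n x - l x\<bar>"
        using x by (intro tendsto_intros l)
      moreover have "\<bar>\<sigma> n x - \<sigma> m x\<bar> \<le> e/2" if "m \<ge> N" for m
        using abs_diff_le_holder1_dist[OF \<sigma> \<sigma> x, of n m] N[OF n that] by linarith
      ultimately have "\<bar>\<sigma> n x - l x\<bar> \<le> e/2"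
        by (intro LIMSEQ_le_const2) auto
      then show "\<bar>\<sigma> n x - f x\<bar> \<le> e/2" using x by (simp add: f_def)
    qed (use e in simp)
    then show ?thesis using e by (intro exI[of _ N]) force
  qed
  then show "\<exists>x. limitin mtopology \<sigma> x sequentially"
    unfolding limit_metric_sequentially by (intro exI[of _ f]) (use fC \<sigma> in auto)
qed

text \<open>
  Baire's theorem, applied to the open sets of which the members are intersections; each of these open
  sets contains a member and is therefore dense.
\<close>

lemma dense_gdeltas_Inter:
  assumes "countable \<G>" "\<G> \<noteq> {}" "\<G> \<subseteq> dense_gdeltas \<alpha> F"
  shows "\<Inter>\<G> \<in> dense_gdeltas \<alpha> F"
proof -
  have \<G>: "gdelta_in mtopology G" "mtopology closure_of G = holder1 \<alpha> F" if "G \<in> \<G>" for G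
    using assms(3) that by (auto simp: dense_gdeltas_def holder1_topology_eq)
  have "\<exists>\<U>. countable \<U> \<and> \<U> \<subseteq> Collect (openin mtopology) \<and> \<Inter>\<U> = G" if "G \<in> \<G>" for G
    using \<G>(1)[OF that] unfolding gdelta_in_alt intersection_of_def by blast
  then obtain \<U> where \<U>: "\<And>G. G \<in> \<G> \<Longrightarrow> countable (\<U> G)"
    "\<And>G. G \<in> \<G> \<Longrightarrow> \<U> G \<subseteq> Collect (openin mtopology)" "\<And>G. G \<in> \<G> \<Longrightarrow> \<Inter>(\<U> G) = G"
    by metis
  have "mtopology closure_of \<Inter>(\<Union>G\<in>\<G>. \<U> G) = holder1 \<alpha> F"
  proof (rule metric_Baire_category[OF mcomplete_holder1])
    fix U assume "U \<in> (\<Union>G\<in>\<G>. \<U> G)"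
    then obtain G where G: "G \<in> \<G>" "U \<in> \<U> G" by blast
    then have "G \<subseteq> U" "openin mtopology U" using \<U>(2,3) by blast+
    moreover have "mtopology closure_of U = holder1 \<alpha> F"
    proof
      show "mtopology closure_of U \<subseteq> holder1 \<alpha> F"
        using closure_of_subset_topspace[of mtopology U] by simp
      show "holder1 \<alpha> F \<subseteq> mtopology closure_of U"
        using closure_of_mono[OF \<open>G \<subseteq> U\<close>, of mtopology] \<G>(2)[OF G(1)] by simp
    qed
    ultimately show "openin mtopology U \<and> mtopology closure_of U = holder1 \<alpha> F" by blast
  qed (use assms(1) \<U>(1) in auto)
  moreover have "\<Inter>(\<Union>G\<in>\<G>. \<U> G) = \<Inter>\<G>" using \<U>(3) by fastforce
  moreover have "gdelta_in mtopology (\<Inter>\<G>)" using assms \<G>(1) by (intro gdelta_in_Inter) auto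
  ultimately show ?thesis by (simp add: dense_gdeltas_def holder1_topology_eq)
qed

section \<open>The \<open>G\<^sub>\<delta>\<close> property\<close>

definition null_level_functions :: "real \<Rightarrow> ('a \<Rightarrow> real) set" where
  "null_level_functions s = {f \<in> holder1 \<alpha> F. null_levels s F f}"

text \<open>
  The functions whose bad levels at scale \<open>1/(n+1)\<close> fit into an open set \<open>W\<close> of measure below
  \<open>1/(n+1)\<close> form an open set \<open>Q n\<close>: the levels outside \<open>W\<close> that matter form a compact set, so
  finitely many of the neighbourhoods from \<open>open_thin_levels_stable\<close> cover them and the same \<open>W\<close>
  serves all nearby functions. The intersection of the \<open>Q n\<close> consists of the functions for which, at
  every scale, the bad levels form a null set.
\<close>

lemma gdelta_null_level_functions:
  assumes s: "0 < s"
  shows "gdelta_in (holder1_topology \<alpha> F) (null_level_functions s)"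
proof -
  define Q where "Q n = {f \<in> holder1 \<alpha> F. \<exists>W. open W \<and> emeasure lebesgue W < ennreal (inverse (Suc n)) \<and>
      (\<forall>r. r \<notin> W \<longrightarrow> open_thin s (inverse (Suc n)) {x \<in> F. f x = r})}" for n
  have "openin (holder1_topology \<alpha> F) (Q n)" for n
    unfolding openin_holder1_iff
  proof (intro conjI ballI)
    fix f assume "f \<in> Q n"
    then obtain W where f: "f \<in> holder1 \<alpha> F"
      and W: "open W" "emeasure lebesgue W < ennreal (inverse (Suc n))"
      and thin: "\<And>r. r \<notin> W \<Longrightarrow> open_thin s (inverse (Suc n)) {x \<in> F. f x = r}"
      unfolding Q_def by blast
    note cont = continuous_on_holder1[OF f]
    obtain M where M: "\<And>x. x \<in> F \<Longrightarrow> \<bar>f x\<bar> \<le> M"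
      using compact_imp_bounded[OF compact_continuous_image[OF cont compact_F]]
      unfolding bounded_iff by auto
    \<comment> \<open>levels outside this interval are not attained by any function within 1 of \<open>f\<close>\<close>
    define K where "K = {-M-1..M+1} - W"
    have K: "compact K" unfolding K_def using W(1) by (intro compact_diff) auto
    define stable where "stable r d \<longleftrightarrow> 0 < d \<and> (\<forall>g r'. (\<forall>x\<in>F. \<bar>g x - f x\<bar> < d) \<longrightarrow> \<bar>r' - r\<bar> < d \<longrightarrow>
        open_thin s (inverse (Suc n)) {x \<in> F. g x = r'})" for r d
    have "\<forall>r\<in>K. \<exists>d. stable r d"
    proof
      fix r assume "r \<in> K"
      then have "r \<notin> W" by (simp add: K_def)
      from open_thin_levels_stable[OF compact_F cont thin[OF this]]
      show "\<exists>d. stable r d" unfolding stable_def .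
    qed
    then obtain \<delta> where \<delta>: "\<forall>r\<in>K. stable r (\<delta> r)" using bchoice[of K stable] by blast
    then have \<delta>_pos: "0 < \<delta> r" if "r \<in> K" for r using that by (simp add: stable_def)
    have "K \<subseteq> (\<Union>r\<in>K. ball r (\<delta> r))" using \<delta>_pos by fastforce
    then obtain D where D: "D \<subseteq> K" "finite D" "K \<subseteq> (\<Union>r\<in>D. ball r (\<delta> r))"
      using compactE_image[OF K, of K "\<lambda>r. ball r (\<delta> r)"] by auto
    define e where "e = Min (insert 1 (\<delta> ` D))"
    have e: "0 < e" "e \<le> 1" "\<And>r. r \<in> D \<Longrightarrow> e \<le> \<delta> r"
      using D \<delta>_pos by (auto simp: e_def)
    have "g \<in> Q n" if g: "g \<in> holder1 \<alpha> F" "\<forall>x\<in>F. \<bar>f x - g x\<bar> < e" for g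
    proof -
      have "open_thin s (inverse (Suc n)) {x \<in> F. g x = r'}" if r': "r' \<notin> W" for r'
      proof (cases "r' \<in> K")
        case True
        then obtain r where r: "r \<in> D" "r' \<in> ball r (\<delta> r)" using D(3) by blast
        have "\<forall>x\<in>F. \<bar>g x - f x\<bar> < \<delta> r"
          using g(2) e(3)[OF r(1)] by (auto simp: abs_minus_commute intro: less_le_trans)
        moreover have "\<bar>r' - r\<bar> < \<delta> r" using r(2) by (simp add: dist_real_def abs_minus_commute)
        moreover have "stable r (\<delta> r)" using \<delta> r(1) D(1) by blast
        ultimately show ?thesis unfolding stable_def by blast
      next
        case False
        have "{x \<in> F. g x = r'} = {}"
        proof (rule ccontr)
          assume "{x \<in> F. g x = r'} \<noteq> {}"
          then obtain x where x: "x \<in> F" "g x = r'" by blast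
          have "\<bar>f x - g x\<bar> < e" using g(2) x(1) by blast
          then have "r' \<in> {-M-1..M+1}" using M[OF x(1)] e(2) x(2) by auto
          then show False using False r' by (simp add: K_def)
        qed
        then show ?thesis by (simp only:) (simp add: open_thin_empty)
      qed
      then show ?thesis unfolding Q_def using W g(1) by blast
    qed
    then show "\<exists>e>0. \<forall>g\<in>holder1 \<alpha> F. (\<forall>x\<in>F. \<bar>f x - g x\<bar> < e) \<longrightarrow> g \<in> Q n"
      using e(1) by blast
  qed (auto simp: Q_def)
  then have "gdelta_in (holder1_topology \<alpha> F) (\<Inter>(range Q))"
    by (intro gdelta_in_Inter) (auto intro: open_imp_gdelta_in)
  moreover have "\<Inter>(range Q) = null_level_functions s"
  proof (intro equalityI subsetI)
    fix f assume "f \<in> null_level_functions s"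
    then have f: "f \<in> holder1 \<alpha> F"
      and N: "negligible {r. hausdorff_measure s {x \<in> F. f x = r} \<noteq> 0}" (is "negligible ?N")
      by (auto simp: null_level_functions_def null_levels_def)
    have null: "?N \<in> null_sets lebesgue" using N negligible_iff_null_sets by blast
    have "f \<in> Q n" for n
    proof -
      obtain W where W: "open W" "?N \<subseteq> W" "W - ?N \<in> lmeasurable"
        "emeasure lebesgue (W - ?N) < ennreal (inverse (Suc n))"
        using sets_lebesgue_outer_open[OF null_setsD2[OF null], of "inverse (Suc n)"] by auto
      have "emeasure lebesgue (W - ?N) = emeasure lebesgue W"
        using null W(1) by (intro emeasure_Diff_null_set) auto
      moreover have "open_thin s (inverse (Suc n)) {x \<in> F. f x = r}" if "r \<notin> W" for r
        using that W(2) hausdorff_measure_0_iff_open_thin_nat[OF s, of "{x \<in> F. f x = r}"] by blast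
      ultimately show ?thesis unfolding Q_def using f W by auto
    qed
    then show "f \<in> \<Inter>(range Q)" by blast
  next
    fix f assume f: "f \<in> \<Inter>(range Q)"
    define N where "N m = {r. \<not> open_thin s (inverse (Suc m)) {x \<in> F. f x = r}}" for m
    have "negligible (N m)" for m
      unfolding negligible_outer
    proof (intro allI impI)
      fix e :: real assume "e > 0"
      then obtain n0 where n0: "inverse (Suc n0) < e" using reals_Archimedean by blast
      define n where "n = max n0 m"
      have le: "inverse (real (Suc n)) \<le> inverse (Suc n0)" "inverse (real (Suc n)) \<le> inverse (Suc m)"
        by (auto simp: n_def)
      have "f \<in> Q n" using f by blast
      then obtain W where W: "open W" "emeasure lebesgue W < ennreal (inverse (Suc n))"
        and thin: "\<And>r. r \<notin> W \<Longrightarrow> open_thin s (inverse (Suc n)) {x \<in> F. f x = r}"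
        unfolding Q_def by blast
      have "N m \<subseteq> W" using open_thin_mono[OF thin le(2)] by (auto simp: N_def)
      moreover have lm: "W \<in> lmeasurable" using W by (intro fmeasurableI) (auto intro: less_trans)
      moreover have "ennreal (measure lebesgue W) < ennreal (inverse (Suc n))"
        using W(2) lm by (simp add: emeasure_eq_measure2)
      then have "measure lebesgue W < inverse (Suc n)" by (simp add: ennreal_less_iff)
      then have "measure lebesgue W < e" using le(1) n0 by linarith
      ultimately show "\<exists>T. N m \<subseteq> T \<and> T \<in> lmeasurable \<and> measure lebesgue T < e" by blast
    qed
    then have "negligible (\<Union>m. N m)" by (rule negligible_Union_nat)
    moreover have "{r. hausdorff_measure s {x \<in> F. f x = r} \<noteq> 0} = (\<Union>m. N m)"
      using hausdorff_measure_0_iff_open_thin_nat[OF s] by (auto simp: N_def)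
    moreover have "f \<in> holder1 \<alpha> F" using f unfolding Q_def by blast
    ultimately show "f \<in> null_level_functions s"
      by (simp add: null_level_functions_def null_levels_def)
  qed
  ultimately show ?thesis by simp
qed

section \<open>Operations on 1-Hoelder functions\<close>

lemma holder1I:
  assumes "f \<in> extensional F"
    and "\<And>x y. x \<in> F \<Longrightarrow> y \<in> F \<Longrightarrow> f x - f y \<le> dist x y powr \<alpha>"
  shows "f \<in> holder1 \<alpha> F"
  unfolding holder1_def
proof (intro CollectI conjI ballI)
  fix x y assume "x \<in> F" "y \<in> F"
  then show "\<bar>f x - f y\<bar> \<le> dist x y powr \<alpha>"
    using assms(2)[of x y] assms(2)[of y x] by (simp add: abs_le_iff dist_commute)
qed (rule assms(1))

lemma holder1D:
  "f \<in> holder1 \<alpha> F \<Longrightarrow> x \<in> F \<Longrightarrow> y \<in> F \<Longrightarrow> f x - f y \<le> dist x y powr \<alpha>"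
  by (auto simp: holder1_def abs_le_iff)

lemma holder1_contraction:
  assumes c: "0 \<le> c" "c < 1" and ext: "f \<in> extensional F"
    and f: "\<And>x y. x \<in> F \<Longrightarrow> y \<in> F \<Longrightarrow> \<bar>f x - f y\<bar> \<le> c * dist x y powr \<alpha>"
  shows "f \<in> holder1 \<alpha> F"
proof (rule holder1I[OF ext])
  fix x y assume "x \<in> F" "y \<in> F"
  then have "f x - f y \<le> c * dist x y powr \<alpha>" using f[of x y] by linarith
  also have "\<dots> \<le> dist x y powr \<alpha>" using c by (intro mult_left_le_one_le) auto
  finally show "f x - f y \<le> dist x y powr \<alpha>" .
qed

lemma holder1_max:
  assumes "f \<in> holder1 \<alpha> F" "g \<in> holder1 \<alpha> F"
  shows "(\<lambda>x\<in>F. max (f x) (g x)) \<in> holder1 \<alpha> F"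
proof (rule holder1I)
  fix x y assume "x \<in> F" "y \<in> F"
  then show "(\<lambda>x\<in>F. max (f x) (g x)) x - (\<lambda>x\<in>F. max (f x) (g x)) y \<le> dist x y powr \<alpha>"
    using holder1D[OF assms(1), of x y] holder1D[OF assms(2), of x y] by (simp add: max_def)
qed auto

lemma holder1_min:
  assumes "f \<in> holder1 \<alpha> F" "g \<in> holder1 \<alpha> F"
  shows "(\<lambda>x\<in>F. min (f x) (g x)) \<in> holder1 \<alpha> F"
proof (rule holder1I)
  fix x y assume "x \<in> F" "y \<in> F"
  then show "(\<lambda>x\<in>F. min (f x) (g x)) x - (\<lambda>x\<in>F. min (f x) (g x)) y \<le> dist x y powr \<alpha>"
    using holder1D[OF assms(1), of x y] holder1D[OF assms(2), of x y] by (simp add: min_def)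
qed auto

lemma holder1_reflect:
  assumes "f \<in> holder1 \<alpha> F"
  shows "(\<lambda>x\<in>F. c - f x) \<in> holder1 \<alpha> F"
proof (rule holder1I)
  fix x y assume "x \<in> F" "y \<in> F"
  then show "(\<lambda>x\<in>F. c - f x) x - (\<lambda>x\<in>F. c - f x) y \<le> dist x y powr \<alpha>"
    using holder1D[OF assms, of y x] by (simp add: dist_commute)
qed auto

lemma holder1_shift:
  assumes "f \<in> holder1 \<alpha> F"
  shows "(\<lambda>x\<in>F. c + f x) \<in> holder1 \<alpha> F"
proof (rule holder1I)
  fix x y assume "x \<in> F" "y \<in> F"
  then show "(\<lambda>x\<in>F. c + f x) x - (\<lambda>x\<in>F. c + f x) y \<le> dist x y powr \<alpha>"
    using holder1D[OF assms, of x y] by simp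
qed auto

lemma holder1_dist_powr: "(\<lambda>z\<in>F. dist z x powr \<alpha>) \<in> holder1 \<alpha> F"
proof (rule holder1I)
  fix z w assume "z \<in> F" "w \<in> F"
  have "dist z x powr \<alpha> \<le> (dist z w + dist w x) powr \<alpha>"
    using alpha_pos by (intro powr_mono2 dist_triangle) auto
  also have "\<dots> \<le> dist z w powr \<alpha> + dist w x powr \<alpha>"
    using alpha_pos alpha_le_1 by (intro powr_subadditive) auto
  finally show "(\<lambda>z\<in>F. dist z x powr \<alpha>) z - (\<lambda>z\<in>F. dist z x powr \<alpha>) w \<le> dist z w powr \<alpha>"
    using \<open>z \<in> F\<close> \<open>w \<in> F\<close> by simp
qed auto

lemma null_level_functions_subset: "null_level_functions s \<subseteq> holder1 \<alpha> F"
  by (auto simp: null_level_functions_def)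

lemma null_level_functions_max:
  assumes "f \<in> null_level_functions s" "g \<in> null_level_functions s"
  shows "(\<lambda>x\<in>F. max (f x) (g x)) \<in> null_level_functions s"
proof -
  have "null_levels s F (\<lambda>x\<in>F. max (f x) (g x))"
  proof (rule null_levels_cover)
    show "null_levels s F f" "null_levels s F g"
      using assms by (auto simp: null_level_functions_def)
    show "{x \<in> F. (\<lambda>x\<in>F. max (f x) (g x)) x = r} \<subseteq> {x \<in> F. f x = r} \<union> {x \<in> F. g x = r}" for r
      by (auto simp: max_def)
  qed (rule negligible_empty)
  then show ?thesis using assms holder1_max by (simp add: null_level_functions_def)
qed

lemma null_level_functions_min:
  assumes "f \<in> null_level_functions s" "g \<in> null_level_functions s"
  shows "(\<lambda>x\<in>F. min (f x) (g x)) \<in> null_level_functions s"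
proof -
  have "null_levels s F (\<lambda>x\<in>F. min (f x) (g x))"
  proof (rule null_levels_cover)
    show "null_levels s F f" "null_levels s F g"
      using assms by (auto simp: null_level_functions_def)
    show "{x \<in> F. (\<lambda>x\<in>F. min (f x) (g x)) x = r} \<subseteq> {x \<in> F. f x = r} \<union> {x \<in> F. g x = r}" for r
      by (auto simp: min_def)
  qed (rule negligible_empty)
  then show ?thesis using assms holder1_min by (simp add: null_level_functions_def)
qed

lemma null_level_functions_reflect:
  assumes "f \<in> null_level_functions s"
  shows "(\<lambda>x\<in>F. c - f x) \<in> null_level_functions s"
proof -
  have "null_levels s F (\<lambda>x\<in>F. c - f x)"
  proof (rule null_levels_reflect)
    show "null_levels s F f" using assms by (simp add: null_level_functions_def)
  qed simp
  then show ?thesis using assms holder1_reflect by (simp add: null_level_functions_def)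
qed

lemma null_level_functions_shift:
  assumes "f \<in> null_level_functions s"
  shows "(\<lambda>x\<in>F. c + f x) \<in> null_level_functions s"
proof -
  have "(\<lambda>x\<in>F. c - (\<lambda>x\<in>F. 0 - f x) x) = (\<lambda>x\<in>F. c + f x)" by (auto simp: restrict_def)
  then show ?thesis
    using null_level_functions_reflect[OF null_level_functions_reflect[OF assms, of 0], of c] by simp
qed

lemma null_level_functions_const: "0 < s \<Longrightarrow> (\<lambda>x\<in>F. c) \<in> null_level_functions s"
  unfolding null_level_functions_def
  by (intro CollectI conjI holder1I null_levels_const[of _ _ _ c]) auto

abbreviation null_level_closure :: "real \<Rightarrow> ('a \<Rightarrow> real) set" where
  "null_level_closure s \<equiv> holder1_topology \<alpha> F closure_of null_level_functions s"

lemmas in_null_level_closure_iff = closure_of_holder1_iff[OF null_level_functions_subset]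

section \<open>From a ball in the closure to density\<close>

text \<open>
  Every ball around \<open>u\<close> contains functions that differ at two given points by almost the radius, or by
  as much as the Hoelder condition permits. The cone \<open>u x + q - dist z x powr \<alpha>\<close> exceeds \<open>u\<close> by at
  most \<open>q\<close>, because \<open>u\<close> itself is 1-Hoelder, and is at most \<open>u x\<close> at \<open>y\<close>; placing it on top of
  \<open>u\<close> separates the values at \<open>x\<close> and \<open>y\<close> if \<open>u y \<le> u x\<close>, and the inverted cone does so
  otherwise.
\<close>

lemma separating_perturbation:
  assumes u: "u \<in> holder1 \<alpha> F" and xy: "x \<in> F" "y \<in> F"
    and q: "0 \<le> q" "q < \<eta>" "q \<le> dist x y powr \<alpha>"
  shows "\<exists>v\<in>holder1 \<alpha> F. (\<forall>z\<in>F. \<bar>u z - v z\<bar> < \<eta>) \<and> q \<le> \<bar>v x - v y\<bar>"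
proof (cases "u y \<le> u x")
  case True
  define p where "p = (\<lambda>z\<in>F. (u x + q) - (\<lambda>z\<in>F. dist z x powr \<alpha>) z)"
  have p: "p z = u x + q - dist z x powr \<alpha>" if "z \<in> F" for z using that by (simp add: p_def)
  have "p \<in> holder1 \<alpha> F" unfolding p_def by (intro holder1_reflect holder1_dist_powr)
  then have v: "(\<lambda>z\<in>F. max (u z) (p z)) \<in> holder1 \<alpha> F" using u by (intro holder1_max)
  have "\<bar>u z - max (u z) (p z)\<bar> < \<eta>" if z: "z \<in> F" for z
    using holder1D[OF u xy(1) z] p[OF z] q(1,2) by (auto simp: max_def dist_commute)
  moreover have "q \<le> \<bar>max (u x) (p x) - max (u y) (p y)\<bar>"
    using p[OF xy(1)] p[OF xy(2)] q(1,3) True by (auto simp: max_def dist_commute)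
  ultimately show ?thesis using v xy by (intro bexI[OF _ v]) auto
next
  case False
  define p where "p = (\<lambda>z\<in>F. (u x - q) + (\<lambda>z\<in>F. dist z x powr \<alpha>) z)"
  have p: "p z = u x - q + dist z x powr \<alpha>" if "z \<in> F" for z using that by (simp add: p_def)
  have "p \<in> holder1 \<alpha> F" unfolding p_def by (intro holder1_shift holder1_dist_powr)
  then have v: "(\<lambda>z\<in>F. min (u z) (p z)) \<in> holder1 \<alpha> F" using u by (intro holder1_min)
  have "\<bar>u z - min (u z) (p z)\<bar> < \<eta>" if z: "z \<in> F" for z
    using holder1D[OF u z xy(1)] p[OF z] q(1,2) by (auto simp: min_def dist_commute)
  moreover have "q \<le> \<bar>min (u x) (p x) - min (u y) (p y)\<bar>"
    using p[OF xy(1)] p[OF xy(2)] q(1,3) False by (auto simp: min_def dist_commute)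
  ultimately show ?thesis using v xy by (intro bexI[OF _ v]) auto
qed

text \<open>
  The centre \<open>u\<close> of the ball is arbitrary, yet all functions of small oscillation are reached. Two-point
  interpolation of \<open>f\<close> is possible with shifted or reflected functions near \<open>u\<close>, since their
  oscillation between \<open>x\<close> and \<open>y\<close> can be made at least that of \<open>f\<close>; the lattice approximation then
  reaches \<open>f\<close> without any further reference to \<open>u\<close>.
\<close>

lemma small_oscillation_in_closure:
  assumes s: "0 < s" and u: "u \<in> holder1 \<alpha> F"
    and ball: "\<And>v. v \<in> holder1 \<alpha> F \<Longrightarrow> (\<forall>z\<in>F. \<bar>u z - v z\<bar> < \<eta>) \<Longrightarrow> v \<in> null_level_closure s"
    and f: "f \<in> holder1 \<alpha> F" and osc: "\<And>x y. x \<in> F \<Longrightarrow> y \<in> F \<Longrightarrow> f x - f y < \<eta>"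
  shows "f \<in> null_level_closure s"
proof (cases "F = {}")
  case True
  then show ?thesis using ball[OF f] by simp
next
  case False
  have "\<exists>g\<in>null_level_functions s. \<forall>z\<in>F. \<bar>f z - g z\<bar> < e" if e: "0 < e" for e
  proof (rule lattice_uniform_approximation[OF compact_F False])
    show "continuous_on F g" if "g \<in> null_level_functions s" for g
      using that null_level_functions_subset continuous_on_holder1 by blast
    show "continuous_on F f" using f by (rule continuous_on_holder1)
    show "\<exists>k\<in>null_level_functions s. \<forall>z\<in>F. k z = min (g z) (h z)"
      if "g \<in> null_level_functions s" "h \<in> null_level_functions s" for g h
      using null_level_functions_min[OF that] by (intro bexI) auto
    show "\<exists>k\<in>null_level_functions s. \<forall>z\<in>F. k z = max (g z) (h z)"
      if "g \<in> null_level_functions s" "h \<in> null_level_functions s" for g h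
      using null_level_functions_max[OF that] by (intro bexI) auto
    fix x y assume xy: "x \<in> F" "y \<in> F"
    show "\<exists>g\<in>null_level_functions s. f x - e < g x \<and> g y < f y + e"
    proof (cases "f x \<le> f y")
      case True
      then show ?thesis
        using null_level_functions_const[OF s, of "f x"] xy e by (intro bexI) auto
    next
      case less: False
      obtain v where v: "v \<in> holder1 \<alpha> F" "\<forall>z\<in>F. \<bar>u z - v z\<bar> < \<eta>" "f x - f y \<le> \<bar>v x - v y\<bar>"
        using separating_perturbation[OF u xy _ osc[OF xy] holder1D[OF f xy]] less by fastforce
      obtain w where w: "w \<in> null_level_functions s" "\<forall>z\<in>F. \<bar>v z - w z\<bar> < e/2"
        using ball[OF v(1,2)] e half_gt_zero unfolding in_null_level_closure_iff by blast
      have wxy: "\<bar>v x - w x\<bar> < e/2" "\<bar>v y - w y\<bar> < e/2" using w(2) xy by auto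
      show ?thesis
      proof (cases "v y \<le> v x")
        case True
        then have "f x - e < f y - v y + w x" "f y - v y + w y < f y + e"
          using wxy v(3) e by linarith+
        then show ?thesis
          using null_level_functions_shift[OF w(1), of "f y - v y"] xy by (intro bexI) auto
      next
        case False
        then have "f x - e < f y + v y - w x" "f y + v y - w y < f y + e"
          using wxy v(3) e by linarith+
        then show ?thesis
          using null_level_functions_reflect[OF w(1), of "f y + v y"] xy by (intro bexI) auto
      qed
    qed
  qed
  then show ?thesis using f by (simp add: in_null_level_closure_iff)
qed

text \<open>
  Folding at \<open>a\<close> halves the range of a function with values between \<open>0\<close> and \<open>2 * a\<close>, and this step
  undoes the fold. If \<open>g\<close> is close to
  the folded function, then \<open>g\<close> cut off at a height \<open>T\<close> slightly below \<open>a\<close> is constant near the set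
  \<open>f = a\<close>; hence it can be continued by its reflection in \<open>T\<close> where \<open>f > a\<close>. Except at
  the level \<open>T\<close>, every level set of the result \<open>\<phi>\<close> is covered by two level sets of \<open>g\<close>.

  The Hoelder bound for \<open>\<phi>\<close> is where the slack \<open>c < 1\<close> is spent. At distances with
  \<open>dist x y powr \<alpha> \<ge> h\<close>, the function \<open>\<phi>\<close> is within \<open>\<theta>\<close> of \<open>\<psi> \<circ> f\<close>, where \<open>\<psi>\<close> is a monotone
  contraction, and the error \<open>2 * \<theta>\<close> is absorbed by \<open>(1 - c) * h\<close>. At smaller distances two points
  on different sides of the fold both have \<open>f\<close> within \<open>h\<close> of \<open>a\<close>, where \<open>\<phi> = T\<close>; points on the same
  side inherit the bound from \<open>g\<close>.
\<close>

lemma unfold_in_closure: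
  assumes c: "0 \<le> c" "c < 1" and ext: "f \<in> extensional F"
    and f: "\<And>x y. x \<in> F \<Longrightarrow> y \<in> F \<Longrightarrow> \<bar>f x - f y\<bar> \<le> c * dist x y powr \<alpha>"
    and fold: "(\<lambda>x\<in>F. min (f x) (2 * a - f x)) \<in> null_level_closure s"
  shows "f \<in> null_level_closure s"
  unfolding in_null_level_closure_iff
proof (intro conjI allI impI)
  show "f \<in> holder1 \<alpha> F" by (rule holder1_contraction[OF c ext f])
next
  fix e :: real assume e: "0 < e"
  define h where "h = e/8"
  define \<theta> where "\<theta> = min (e/8) ((1 - c) * h / 2)"
  have h: "0 < h" using e by (simp add: h_def)
  have "0 < (1 - c) * h" using h c by simp
  moreover have "\<theta> \<le> (1 - c) * h / 2" by (simp add: \<theta>_def)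
  ultimately have \<theta>: "0 < \<theta>" "\<theta> \<le> e/8" "2 * \<theta> \<le> (1 - c) * h"
    using e by (simp_all add: \<theta>_def)
  obtain g where g: "g \<in> null_level_functions s"
    and g_near: "\<And>x. x \<in> F \<Longrightarrow> \<bar>min (f x) (2 * a - f x) - g x\<bar> < \<theta>"
    using fold \<theta>(1) unfolding in_null_level_closure_iff by force
  define T where "T = a - \<theta> - h"
  define \<phi> where "\<phi> = (\<lambda>x\<in>F. if f x \<le> a then min (g x) T else 2 * T - min (g x) T)"
  \<comment> \<open>the same cut-off and reflection, applied to \<open>f\<close> itself\<close>
  define \<psi> where "\<psi> t = (if t \<le> a then min t T else 2 * T - min (2 * a - t) T)" for t
  have \<psi>_mono: "0 \<le> \<psi> t' - \<psi> t \<and> \<psi> t' - \<psi> t \<le> t' - t" if "t \<le> t'" for t t'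
    using that \<theta>(1) h by (auto simp: \<psi>_def T_def min_def)
  have \<psi>: "\<bar>\<psi> t - \<psi> t'\<bar> \<le> \<bar>t - t'\<bar>" for t t'
    using \<psi>_mono[of t t'] \<psi>_mono[of t' t] by linarith
  have \<phi>_near: "\<bar>\<phi> x - \<psi> (f x)\<bar> < \<theta>" if "x \<in> F" for x
    using g_near[OF that] that by (auto simp: \<phi>_def \<psi>_def T_def min_def split: if_splits)
  have "\<phi> \<in> holder1 \<alpha> F"
  proof (rule holder1I)
    fix x y assume xy: "x \<in> F" "y \<in> F"
    define d where "d = dist x y powr \<alpha>"
    have fd: "\<bar>f x - f y\<bar> \<le> c * d" using f[OF xy] by (simp add: d_def)
    have gd: "\<bar>g x - g y\<bar> \<le> d"
      using g xy null_level_functions_subset by (auto simp: d_def holder1_def)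
    have "\<phi> x - \<phi> y \<le> d"
    proof (cases "h \<le> d")
      case True
      have "\<phi> x - \<phi> y \<le> \<bar>f x - f y\<bar> + 2 * \<theta>"
        using \<phi>_near[OF xy(1)] \<phi>_near[OF xy(2)] \<psi>[of "f x" "f y"] by linarith
      also have "\<dots> \<le> c * d + (1 - c) * h" using fd \<theta>(3) by linarith
      also have "\<dots> \<le> c * d + (1 - c) * d" using True c by (intro add_left_mono mult_left_mono) auto
      finally show ?thesis by (simp add: algebra_simps)
    next
      case False
      have "0 \<le> d" by (simp add: d_def)
      then have "c * d \<le> d" using c by (intro mult_left_le_one_le) auto
      then have near: "\<bar>f x - f y\<bar> < h" using fd False by linarith
      show ?thesis
      proof (cases "f x \<le> a \<longleftrightarrow> f y \<le> a")
        case True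
        then show ?thesis using gd xy by (auto simp: \<phi>_def min_def)
      next
        case False
        have "T \<le> g x" "T \<le> g y"
          using False near g_near[OF xy(1)] g_near[OF xy(2)] by (auto simp: T_def min_def split: if_splits)
        then show ?thesis using xy \<open>0 \<le> d\<close> by (auto simp: \<phi>_def)
      qed
    qed
    then show "\<phi> x - \<phi> y \<le> dist x y powr \<alpha>" by (simp add: d_def)
  qed (simp add: \<phi>_def)
  moreover have "null_levels s F \<phi>"
  proof (rule null_levels_cover)
    show "null_levels s F g" using g by (simp add: null_level_functions_def)
    then show "null_levels s F (\<lambda>x. 2 * T - g x)" by (rule null_levels_reflect) simp
    show "negligible {T}" by simp
    \<comment> \<open>at the level \<open>T\<close> itself, \<open>\<phi>\<close> is constant on a possibly large set\<close>
    show "{x \<in> F. \<phi> x = r} \<subseteq> {x \<in> F. g x = r} \<union> {x \<in> F. 2 * T - g x = r}" if "r \<notin> {T}" for r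
      using that by (auto simp: \<phi>_def min_def split: if_splits)
  qed
  ultimately have "\<phi> \<in> null_level_functions s" by (simp add: null_level_functions_def)
  moreover have "\<bar>f x - \<phi> x\<bar> < e" if "x \<in> F" for x
  proof -
    have "\<bar>\<psi> t - t\<bar> \<le> 2 * (a - T)" for t
      using \<theta>(1) h by (auto simp: \<psi>_def T_def min_def)
    from this[of "f x"] \<phi>_near[OF that] show ?thesis
      using \<theta>(2) h e by (auto simp: T_def h_def)
  qed
  ultimately show "\<exists>\<phi>\<in>null_level_functions s. \<forall>x\<in>F. \<bar>f x - \<phi> x\<bar> < e" by blast
qed

text \<open>
  One ball in the closure is enough for density. Functions of small oscillation lie in the closure;
  repeated unfolding doubles the admissible range, so all functions with Hoelder constant below \<open>1\<close>
  lie in it; and these are dense, as \<open>(1 - t) * f\<close> tends to \<open>f\<close>.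
\<close>

lemma null_level_functions_dense:
  assumes s: "0 < s" and u: "u \<in> holder1 \<alpha> F" and \<eta>: "0 < \<eta>"
    and ball: "\<And>v. v \<in> holder1 \<alpha> F \<Longrightarrow> (\<forall>z\<in>F. \<bar>u z - v z\<bar> < \<eta>) \<Longrightarrow> v \<in> null_level_closure s"
  shows "null_level_closure s = holder1 \<alpha> F"
proof (intro equalityI subsetI)
  fix f assume fC: "f \<in> holder1 \<alpha> F"
  have range: "f \<in> null_level_closure s"
    if "0 \<le> c" "c < 1" "f \<in> extensional F"
      "\<And>x y. x \<in> F \<Longrightarrow> y \<in> F \<Longrightarrow> \<bar>f x - f y\<bar> \<le> c * dist x y powr \<alpha>"
      "\<And>x. x \<in> F \<Longrightarrow> 0 \<le> f x \<and> f x \<le> 2^n * (\<eta>/2)" for f c n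
    using that(3-5)
  proof (induction n arbitrary: f)
    case 0
    show ?case
    proof (rule small_oscillation_in_closure[OF s u ball])
      show "f \<in> holder1 \<alpha> F" by (rule holder1_contraction[OF that(1,2) 0(1,2)])
      fix x y assume "x \<in> F" "y \<in> F"
      then have "f x \<le> \<eta>/2" "0 \<le> f y" using 0(3)[of x] 0(3)[of y] by auto
      then show "f x - f y < \<eta>" using \<eta> by linarith
    qed
  next
    case (Suc n)
    define a where "a = 2^n * (\<eta>/2)"
    show ?case
    proof (rule unfold_in_closure[OF that(1,2) Suc.prems(1,2)])
      show "(\<lambda>x\<in>F. min (f x) (2 * a - f x)) \<in> null_level_closure s"
      proof (rule Suc.IH)
        fix x y assume xy: "x \<in> F" "y \<in> F"
        have "\<bar>min (f x) (2 * a - f x) - min (f y) (2 * a - f y)\<bar> \<le> \<bar>f x - f y\<bar>"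
          by (auto simp: min_def)
        then show "\<bar>(\<lambda>x\<in>F. min (f x) (2 * a - f x)) x - (\<lambda>x\<in>F. min (f x) (2 * a - f x)) y\<bar>
            \<le> c * dist x y powr \<alpha>"
          using Suc.prems(2)[OF xy] xy by simp
      next
        fix x assume x: "x \<in> F"
        then have "0 \<le> f x" "f x \<le> 2 * a" using Suc.prems(3)[OF x] by (auto simp: a_def)
        then have "0 \<le> min (f x) (2 * a - f x)" "min (f x) (2 * a - f x) \<le> a" by auto
        then show "0 \<le> (\<lambda>x\<in>F. min (f x) (2 * a - f x)) x \<and>
            (\<lambda>x\<in>F. min (f x) (2 * a - f x)) x \<le> 2^n * (\<eta>/2)"
          unfolding a_def[symmetric] using x by simp
      qed (rule restrict_extensional)
    qed
  qed
  show "f \<in> null_level_closure s"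
    unfolding in_null_level_closure_iff
  proof (intro conjI allI impI fC)
    fix e :: real assume e: "0 < e"
    obtain B0 where B0: "\<And>x. x \<in> F \<Longrightarrow> \<bar>f x\<bar> \<le> B0"
      using compact_imp_bounded[OF compact_continuous_image[OF continuous_on_holder1[OF fC] compact_F]]
      unfolding bounded_iff by auto
    define B where "B = max B0 1"
    have B: "1 \<le> B" "\<And>x. x \<in> F \<Longrightarrow> \<bar>f x\<bar> \<le> B" using B0 by (auto simp: B_def max_def intro: order_trans)
    define t where "t = min (1/2) (e / (2 * B))"
    have t: "0 < t" "t \<le> 1/2" "t * B \<le> e/2"
      using e B(1) by (auto simp: t_def min_def field_simps)
    obtain n :: nat where n: "2 * B / (\<eta>/2) < 2^n"
      using real_arch_pow[of 2 "2 * B / (\<eta>/2)"] by auto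
    \<comment> \<open>scaling gives a Hoelder constant below 1, and the shift by \<open>B\<close> makes the range nonnegative\<close>
    define f0 where "f0 = (\<lambda>x\<in>F. B + (1 - t) * f x)"
    have "f0 \<in> null_level_closure s"
    proof (rule range[of "1 - t"])
      fix x y assume xy: "x \<in> F" "y \<in> F"
      have "\<bar>f0 x - f0 y\<bar> = (1 - t) * \<bar>f x - f y\<bar>"
        using xy t by (simp add: f0_def abs_mult flip: right_diff_distrib)
      also have "\<dots> \<le> (1 - t) * dist x y powr \<alpha>"
        using fC xy t by (intro mult_left_mono) (auto simp: holder1_def)
      finally show "\<bar>f0 x - f0 y\<bar> \<le> (1 - t) * dist x y powr \<alpha>" .
    next
      fix x assume x: "x \<in> F"
      have "\<bar>(1 - t) * f x\<bar> \<le> 1 * B"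
        unfolding abs_mult using t B(2)[OF x] by (intro mult_mono) auto
      moreover have "2 * B < 2^n * (\<eta>/2)" using n \<eta> by (simp add: field_simps)
      ultimately show "0 \<le> f0 x \<and> f0 x \<le> 2^n * (\<eta>/2)"
        using x by (auto simp: f0_def abs_le_iff)
    qed (use t in \<open>auto simp: f0_def\<close>)
    then obtain g where g: "g \<in> null_level_functions s" "\<forall>x\<in>F. \<bar>f0 x - g x\<bar> < e/2"
      using e half_gt_zero unfolding in_null_level_closure_iff by blast
    have "\<bar>f x - (- B + g x)\<bar> < e" if x: "x \<in> F" for x
    proof -
      have "\<bar>t * f x\<bar> \<le> t * B" unfolding abs_mult using t B(2)[OF x] by (intro mult_mono) auto
      moreover have "\<bar>B + (1 - t) * f x - g x\<bar> < e/2" using g(2) x by (simp add: f0_def)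
      moreover have "(1 - t) * f x = f x - t * f x" by (simp add: algebra_simps)
      ultimately show ?thesis using t(3) by linarith
    qed
    then show "\<exists>g\<in>null_level_functions s. \<forall>x\<in>F. \<bar>f x - g x\<bar> < e"
      using null_level_functions_shift[OF g(1), of "- B"] by (intro bexI) auto
  qed
qed (simp add: in_null_level_closure_iff)

section \<open>The generic value\<close>

lemma holder1_in_dense_gdeltas: "holder1 \<alpha> F \<in> dense_gdeltas \<alpha> F"
  using gdelta_in_topspace[of "holder1_topology \<alpha> F"] closure_of_topspace[of "holder1_topology \<alpha> F"]
  by (simp add: dense_gdeltas_def)

lemma Dstar_nonneg: "0 \<le> Dstar \<alpha> F"
proof -
  have "(INF f\<in>holder1 \<alpha> F. Dstar_fun f F) \<le> Dstar \<alpha> F"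
    unfolding Dstar_def by (rule SUP_upper[OF holder1_in_dense_gdeltas])
  moreover have "0 \<le> (INF f\<in>holder1 \<alpha> F. Dstar_fun f F)"
    by (intro INF_greatest Dstar_fun_nonneg)
  ultimately show ?thesis by (rule order_trans[rotated])
qed

text \<open>
  Otherwise the complement of the closure would be open and dense, and on it every \<open>Dstar_fun f F\<close> is
  at least \<open>s\<close>; being one of the competitors in the definition of \<^const>\<open>Dstar\<close>, it would force
  \<open>Dstar \<alpha> F \<ge> s\<close>.
\<close>

lemma null_level_closure_has_ball:
  assumes "Dstar \<alpha> F < ereal s"
  shows "\<exists>u\<in>holder1 \<alpha> F. \<exists>\<eta>>0. \<forall>v\<in>holder1 \<alpha> F. (\<forall>z\<in>F. \<bar>u z - v z\<bar> < \<eta>) \<longrightarrow> v \<in> null_level_closure s"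
proof (rule ccontr)
  assume no_ball: "\<not> ?thesis"
  define G where "G = holder1 \<alpha> F - null_level_closure s"
  have "openin (holder1_topology \<alpha> F) G"
    unfolding G_def using openin_topspace[of "holder1_topology \<alpha> F"] closedin_closure_of
    by (intro openin_diff) auto
  moreover have "f \<in> holder1_topology \<alpha> F closure_of G" if "f \<in> holder1 \<alpha> F" for f
  proof -
    have "\<exists>v\<in>G. \<forall>x\<in>F. \<bar>f x - v x\<bar> < e" if "0 < e" for e
      using no_ball \<open>f \<in> holder1 \<alpha> F\<close> that unfolding G_def by blast
    then show ?thesis using that by (subst closure_of_holder1_iff) (auto simp: G_def)
  qed
  then have "holder1_topology \<alpha> F closure_of G = holder1 \<alpha> F"
    using closure_of_subset_topspace[of "holder1_topology \<alpha> F" G] by auto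
  ultimately have "G \<in> dense_gdeltas \<alpha> F"
    by (simp add: dense_gdeltas_def open_imp_gdelta_in)
  then have "(INF f\<in>G. Dstar_fun f F) \<le> Dstar \<alpha> F"
    unfolding Dstar_def by (rule SUP_upper)
  moreover have "ereal s \<le> (INF f\<in>G. Dstar_fun f F)"
  proof (rule INF_greatest)
    fix f assume f: "f \<in> G"
    then have fC: "f \<in> holder1 \<alpha> F" and "f \<notin> null_level_functions s"
      using closure_of_subset[of "null_level_functions s" "holder1_topology \<alpha> F"]
        null_level_functions_subset by (auto simp: G_def)
    then show "ereal s \<le> Dstar_fun f F"
      using Dstar_fun_less_imp_null_levels[OF compact_F continuous_on_holder1[OF fC]]
      by (force simp: null_level_functions_def not_le[symmetric])
  qed
  ultimately show False using assms by order
qed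

lemma null_level_functions_dense_gdelta:
  assumes "Dstar \<alpha> F < ereal s"
  shows "null_level_functions s \<in> dense_gdeltas \<alpha> F"
proof -
  have "0 < ereal s" using Dstar_nonneg assms by (rule le_less_trans)
  then have s: "0 < s" by simp
  obtain u \<eta> where u: "u \<in> holder1 \<alpha> F" and \<eta>: "0 < \<eta>"
    and ball: "\<forall>v\<in>holder1 \<alpha> F. (\<forall>z\<in>F. \<bar>u z - v z\<bar> < \<eta>) \<longrightarrow> v \<in> null_level_closure s"
    using null_level_closure_has_ball[OF assms] by blast
  have "null_level_closure s = holder1 \<alpha> F"
    by (rule null_level_functions_dense[OF s u \<eta>]) (use ball in blast)
  then show ?thesis
    using gdelta_null_level_functions[OF s] by (simp add: dense_gdeltas_def)
qed

lemma generic_Dstar_fun_eq_Dstar: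
  "\<exists>G\<in>dense_gdeltas \<alpha> F. \<forall>f\<in>G. Dstar_fun f F = Dstar \<alpha> F"
proof -
  have "dense_gdeltas \<alpha> F \<noteq> {}" using holder1_in_dense_gdeltas by blast
  then obtain h :: "nat \<Rightarrow> ereal" where h: "range h \<subseteq> (\<lambda>G. INF f\<in>G. Dstar_fun f F) ` dense_gdeltas \<alpha> F"
    "Dstar \<alpha> F = (SUP n. h n)"
    unfolding Dstar_def using Sup_countable_SUP by (metis image_is_empty)
  then have "\<forall>n. \<exists>G\<in>dense_gdeltas \<alpha> F. h n = (INF f\<in>G. Dstar_fun f F)" by blast
  then obtain G where G: "\<And>n. G n \<in> dense_gdeltas \<alpha> F" "\<And>n. h n = (INF f\<in>G n. Dstar_fun f F)"
    by metis
  \<comment> \<open>rational thresholds keep the family of conditions from above countable\<close>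
  define Q where "Q = {s \<in> \<rat>. Dstar \<alpha> F < ereal s}"
  have "countable Q" unfolding Q_def by (rule countable_subset[OF _ countable_rat]) auto
  define H where "H = \<Inter>(range G \<union> null_level_functions ` Q)"
  have "H \<in> dense_gdeltas \<alpha> F"
    unfolding H_def using \<open>countable Q\<close> G(1) null_level_functions_dense_gdelta
    by (intro dense_gdeltas_Inter) (auto simp: Q_def)
  moreover have "Dstar_fun f F = Dstar \<alpha> F" if f: "f \<in> H" for f
  proof (rule antisym)
    show "Dstar \<alpha> F \<le> Dstar_fun f F"
      unfolding h(2)
    proof (rule SUP_least)
      fix n show "h n \<le> Dstar_fun f F"
        unfolding G(2) using f by (intro INF_lower) (auto simp: H_def)
    qed
    show "Dstar_fun f F \<le> Dstar \<alpha> F"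
    proof (rule ccontr)
      assume "\<not> Dstar_fun f F \<le> Dstar \<alpha> F"
      then have "Dstar \<alpha> F < Dstar_fun f F" by simp
      then obtain t where t: "Dstar \<alpha> F < ereal t" "ereal t < Dstar_fun f F"
        using ereal_dense2 by blast
      then obtain t' where t': "ereal t < ereal t'" "ereal t' < Dstar_fun f F"
        using ereal_dense2 by blast
      then obtain q where q: "q \<in> \<rat>" "t < q" "q < t'" using Rats_dense_in_real[of t t'] by force
      have "ereal t < ereal q" "ereal q < ereal t'" using q by auto
      then have Dq: "Dstar \<alpha> F < ereal q" "ereal q < Dstar_fun f F" using t(1) t'(2) by order+
      then have "f \<in> null_level_functions q" using f q(1) unfolding H_def Q_def by blast
      then have "null_levels q F f" by (simp add: null_level_functions_def)
      moreover have "0 < ereal q" using Dstar_nonneg Dq(1) by (rule le_less_trans)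
      ultimately have "Dstar_fun f F \<le> ereal q" by (intro null_levels_imp_Dstar_fun_le) auto
      then show False using Dq(2) by simp
    qed
  qed
  ultimately show ?thesis by blast
qed

end

theorem theorem3p3:
  fixes \<alpha> :: real and F :: "(real ^ 'p) set"
  assumes "0 < \<alpha>" and "\<alpha> \<le> 1" and "compact F"
  shows "\<exists>G \<in> dense_gdeltas \<alpha> F. \<forall>f \<in> G. Dstar_fun f F = Dstar \<alpha> F"
proof -
  interpret holder_space \<alpha> F using assms by unfold_locales
  show ?thesis by (rule generic_Dstar_fun_eq_Dstar)
qed

end
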